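(* Let $X$ be a Banach space, $f:X\to\mathbb{R}\cup\{+\infty\}$ lower semicontinuous and $\bar x\in[f\le0]$. Let $\tau>0$, $\delta\in(0,\infty]$ and $q\in(0,1]$. Suppose that either $X$ is Asplund or $f$ is convex, and $$d(x,[f\le0])^{q-1}\, d(0,\partial f(x))^q\ge\tau\quad\text{for all } x\in B_\delta(\bar x)\cap[f>0]\text{ with } f^q(x)<\tau\, d(x,[f\le0]).$$ Then $\alpha^q(1-\alpha)^{1-q}\tau\, d(x,[f\le0])\le f_+^q(x)$ for all $\alpha\in(0,1)$ and all $x\in B_{\delta/(1+\alpha)}(\bar x)$.
   Context: $[f\le0]=\{x: f(x)\le0\}$, $[f>0]=\{x:f(x)>0\}$, $f_+(x)=\max\{f(x),0\}$; for $f(x)\ge0$, $f^q(x):=[f(x)]^q$, $f_+^q(x)=[f_+(x)]^q$. $B_\delta(x)$ is the open ball of radius $\delta$ centered at $x$ ($B_\infty(x)=X$). $d(x,A)=\inf_{a\in A}\|x-a\|$, $d(x,\emptyset)=+\infty$. $\partial f(x)$ is the Fréchet subdifferential: $\{x^*\in X^*:\liminf_{y\to x}\frac{f(y)-f(x)-\langle x^*,y-x\rangle}{\|y-x\|}\ge0\}$ if $f(x)<+\infty$, $\emptyset$ otherwise (equal to the convex subdifferential for convex $f$); $d(0,\partial f(x))=\inf\{\|x^*\|:x^*\in\partial f(x)\}$ ($+\infty$ if empty). A Banach space is Asplund if every continuous convex function on an open convex subset is Fréchet differentiable on a dense subset. *)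

theory Defs
  imports "HOL-Analysis.Analysis"
begin

text \<open>Extended-real valued functions f : X -> R u {+oo} are modelled as maps into ereal
  that never take the value -oo.\<close>

definition lsc :: "('a::topological_space \<Rightarrow> ereal) \<Rightarrow> bool" where
  "lsc f \<longleftrightarrow> (\<forall>x. f x \<le> Liminf (at x) f)"

definition ext_convex :: "('a::real_vector \<Rightarrow> ereal) \<Rightarrow> bool" where
  "ext_convex f \<longleftrightarrow> (\<forall>x y t. 0 \<le> t \<and> t \<le> 1 \<longrightarrow>
      f ((1 - t) *\<^sub>R x + t *\<^sub>R y) \<le> ereal (1 - t) * f x + ereal t * f y)"

definition frechet_subdiff :: "('a::real_normed_vector \<Rightarrow> ereal) \<Rightarrow> 'a \<Rightarrow> ('a \<Rightarrow>\<^sub>L real) set" where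
  "frechet_subdiff f x =
     (if f x < \<infinity> then
        {x'. Liminf (at x) (\<lambda>y. (f y - f x - ereal (blinfun_apply x' (y - x))) / ereal (norm (y - x))) \<ge> 0}
      else {})"

text \<open>d(0, subdiff f x) = inf of dual norms, +oo if the subdifferential is empty.\<close>
definition dist_subdiff :: "('a::real_normed_vector \<Rightarrow> ereal) \<Rightarrow> 'a \<Rightarrow> ereal" where
  "dist_subdiff f x = (INF x' \<in> frechet_subdiff f x. ereal (norm x'))"

text \<open>d(x, A) = inf_{a in A} |x - a|, with d(x, {}) = +oo.\<close>
definition edist_set :: "'a::metric_space \<Rightarrow> 'a set \<Rightarrow> ereal" where
  "edist_set x A = (INF a \<in> A. ereal (dist x a))"

definition eball :: "'a::metric_space \<Rightarrow> ereal \<Rightarrow> 'a set" where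
  "eball c r = {x. ereal (dist c x) < r}"

text \<open>Power t^p of a nonnegative extended real t with real exponent p, with the usual
  conventions oo^p = oo (p>0), 0^p = oo (p<0), t^0 = 1.\<close>
definition epow :: "ereal \<Rightarrow> real \<Rightarrow> ereal" where
  "epow t p =
     (if p = 0 then 1
      else if t = \<infinity> then (if p > 0 then \<infinity> else 0)
      else if t = 0 then (if p > 0 then 0 else \<infinity>)
      else ereal (real_of_ereal t powr p))"

definition asplund :: "'a::real_normed_vector itself \<Rightarrow> bool" where
  "asplund _ \<longleftrightarrow> (\<forall>(U::'a set) (g::'a \<Rightarrow> real).
      open U \<and> convex U \<and> continuous_on U g \<and> convex_on U g \<longrightarrow>
      (\<exists>D \<subseteq> U. U \<subseteq> closure D \<and> (\<forall>x\<in>D. g differentiable (at x))))"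

end

theory Submission
  imports Defs
begin

text \<open>
  If the claim fails at \<open>x\<close>, Ekeland's principle applied to \<open>f\<^sub>+\<close> produces a point \<open>x\<^sub>h\<close> close to \<open>x\<close>
  that minimises \<open>f\<^sub>+ + \<kappa> * norm (\<cdot> - x\<^sub>h)\<close> with a slope \<open>\<kappa>\<close> too small for the slope condition; it
  remains to find a Frechet subgradient of norm about \<open>\<kappa>\<close> near \<open>x\<^sub>h\<close>. For convex \<open>f\<close> this is the
  Hahn--Banach theorem.

  For an Asplund space, Hahn--Banach turns the absence of a small subgradient into finite
  configurations of points, so it is enough to find the subgradient relative to a suitable closed
  separable subspace \<open>Y\<close>. The dual of \<open>Y\<close> is separable: otherwise there is an uncountable
  separated set \<open>A\<close> of functionals on \<open>Y\<close> none of whose nonempty slices is a singleton, and a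
  minimal sublinear functional on the whole space dominating \<open>A\<close> on \<open>Y\<close> is nowhere Frechet
  differentiable. With a sequence \<open>d\<^sub>n\<close> dense in the dual ball of \<open>Y\<close>, the norm is uniformly
  approximated by functions \<open>z \<mapsto> sup\<^sub>u (u z - \<Phi> u)\<close>, where \<open>\<Phi>\<close> is a small weighted sum of the
  squared distances to the \<open>d\<^sub>n\<close> and of squared evaluations; these are Frechet differentiable along
  \<open>Y\<close>. Perturbing \<open>f\<close> by a series of such functions yields an exact minimum, hence the subgradient.
\<close>

section \<open>Sublinear functionals and the Hahn--Banach theorem\<close>

text \<open>With d the distance from x to the sublevel set, the constant comes from splitting d: a
  slope slightly above f(x)/(\<alpha> d) keeps the Ekeland point within \<alpha> d of x, so it is
  still (1 - \<alpha>) d away from the set, and failure of the claim says exactly that the q-th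
  power of this slope can be kept below \<tau> ((1 - \<alpha>) d)^(1 - q). These inequalities are
  strict, and one margin \<eta> absorbs the error made when the subgradient is found only near x_h.

  The obstacle is the Asplund case. The hypothesis concerns convex functions on the whole space,
  which may carry no smooth equivalent norm, so smoothness is sought only along a separable
  subspace, and only as an upper first-order estimate, all that a minimum requires. Functionals are
  kept on the whole space and compared by their values on Y, so that neither Y nor its dual becomes
  a type; the Hahn-Banach theorem extends limits and restrictions back.\<close>

definition sublinear :: "('a::real_vector \<Rightarrow> real) \<Rightarrow> bool" where
  "sublinear p \<longleftrightarrow> (\<forall>x y. p (x + y) \<le> p x + p y) \<and> (\<forall>t x. 0 \<le> t \<longrightarrow> p (t *\<^sub>R x) = t * p x)"

lemma sublinearI:
  assumes "\<And>x y. p (x + y) \<le> p x + p y" "\<And>t x. 0 < t \<Longrightarrow> p (t *\<^sub>R x) \<le> t * p x" "p 0 = 0"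
  shows "sublinear p"
proof -
  have "p (t *\<^sub>R x) = t * p x" if "0 \<le> t" for t x
  proof (cases "t = 0")
    case False
    then have t: "0 < t" using that by simp
    have "p (inverse t *\<^sub>R (t *\<^sub>R x)) \<le> inverse t * p (t *\<^sub>R x)"
      using t by (intro assms(2)) simp
    then have "t * p x \<le> p (t *\<^sub>R x)"
      using t by (simp add: field_simps)
    with assms(2)[OF t, of x] show ?thesis by simp
  qed (simp add: assms(3))
  then show ?thesis
    using assms(1) unfolding sublinear_def by blast
qed

lemma sublinear_add: "sublinear p \<Longrightarrow> p (x + y) \<le> p x + p y"
  by (simp add: sublinear_def)

lemma sublinear_scale: "sublinear p \<Longrightarrow> 0 \<le> t \<Longrightarrow> p (t *\<^sub>R x) = t * p x"
  by (simp add: sublinear_def)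

lemma sublinear_zero: "sublinear p \<Longrightarrow> p 0 = 0"
  using sublinear_scale[of p 0 0] by simp

lemma sublinear_neg: "sublinear p \<Longrightarrow> - p (- x) \<le> p x"
  using sublinear_add[of p x "- x"] sublinear_zero[of p] by simp

lemma sublinear_norm: "0 \<le> c \<Longrightarrow> sublinear (\<lambda>x::'a::real_normed_vector. c * norm x)"
  by (rule sublinearI) (auto simp: norm_triangle_ineq mult_left_mono simp flip: distrib_left)

text \<open>Finiteness of the infimum comes from the uniform bound \<open>- p (- x)\<close>.
  Subadditivity can fail for an arbitrary family; in a chain the smaller of two near-optimal members
  serves both arguments.\<close>

lemma sublinear_Inf_chain:
  assumes ne: "C \<noteq> {}" and sub': "\<forall>q\<in>C. sublinear q" and le': "\<forall>q\<in>C. \<forall>x. q x \<le> p x"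
    and chain': "\<forall>q\<in>C. \<forall>r\<in>C. q \<le> r \<or> r \<le> q"
  shows "sublinear (\<lambda>x. INF q\<in>C. q x)" "\<And>q x. q \<in> C \<Longrightarrow> (INF q\<in>C. q x) \<le> q x"
proof -
  note sub = bspec[OF sub'] and le = spec[OF bspec[OF le']] and chain = bspec[OF bspec[OF chain']]
  have low: "- p (- x) \<le> q x" if "q \<in> C" for q x
    using sublinear_neg[OF sub[OF that], of x] le[OF that, of "- x"] by linarith
  have bdd: "bdd_below ((\<lambda>q. q x) ` C)" for x
    using low by (auto intro!: bdd_belowI)
  show inf_le: "(INF q\<in>C. q x) \<le> q x" if "q \<in> C" for q x
    using that by (rule cINF_lower[OF bdd])
  show "sublinear (\<lambda>x. INF q\<in>C. q x)"
  proof (rule sublinearI)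
    fix x y
    show "(INF q\<in>C. q (x + y)) \<le> (INF q\<in>C. q x) + (INF q\<in>C. q y)"
    proof (rule field_le_epsilon)
      fix e :: real assume "0 < e"
      then have e2: "(INF q\<in>C. q x) < (INF q\<in>C. q x) + e/2" "(INF q\<in>C. q y) < (INF q\<in>C. q y) + e/2" by auto
      obtain q where q: "q \<in> C" "q x < (INF q\<in>C. q x) + e/2"
        using e2(1) cINF_less_iff[OF ne bdd] by blast
      obtain r where r: "r \<in> C" "r y < (INF q\<in>C. q y) + e/2"
        using e2(2) cINF_less_iff[OF ne bdd] by blast
      obtain s where s: "s \<in> C" "s \<le> q" "s \<le> r"
        using chain[OF q(1) r(1)] q(1) r(1) by blast
      have "(INF q\<in>C. q (x + y)) \<le> s (x + y)" by (rule inf_le[OF s(1)])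
      also have "\<dots> \<le> s x + s y" by (rule sublinear_add[OF sub[OF s(1)]])
      also have "\<dots> \<le> q x + r y" using s by (intro add_mono) (auto simp: le_fun_def)
      finally show "(INF q\<in>C. q (x + y)) \<le> (INF q\<in>C. q x) + (INF q\<in>C. q y) + e"
        using q r by linarith
    qed
  next
    fix t :: real and x assume t: "0 < t"
    have "inverse t * (INF q\<in>C. q (t *\<^sub>R x)) \<le> (INF q\<in>C. q x)"
    proof (rule cINF_greatest[OF ne])
      fix q assume q: "q \<in> C"
      have "(INF q\<in>C. q (t *\<^sub>R x)) \<le> t * q x"
        using inf_le[OF q, of "t *\<^sub>R x"] sublinear_scale[OF sub[OF q], of t x] t by simp
      then show "inverse t * (INF q\<in>C. q (t *\<^sub>R x)) \<le> q x"
        using t by (simp add: field_simps)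
    qed
    then show "(INF q\<in>C. q (t *\<^sub>R x)) \<le> t * (INF q\<in>C. q x)"
      using t by (simp add: field_simps)
  next
    have "(\<lambda>q. q 0) ` C = {0}"
      using ne sublinear_zero[OF sub] by force
    then show "(INF q\<in>C. q 0) = 0" by simp
  qed
qed

text \<open>Zorn's lemma for the reversed pointwise order. The barrier \<open>g\<close> is an
  arbitrary function: with \<open>Y\<close> empty a minimal element turns out to be linear, and with
  a supremum of functionals as \<open>g\<close> it is the function tested for
  differentiability.\<close>

lemma minimal_sublinear:
  fixes p :: "'a::real_vector \<Rightarrow> real"
  assumes p: "sublinear p" and g: "\<And>y. y \<in> Y \<Longrightarrow> g y \<le> p y"
  shows "\<exists>q. sublinear q \<and> (\<forall>x. q x \<le> p x) \<and> (\<forall>y\<in>Y. g y \<le> q y) \<and>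
    (\<forall>r. sublinear r \<longrightarrow> (\<forall>x. r x \<le> q x) \<longrightarrow> (\<forall>y\<in>Y. g y \<le> r y) \<longrightarrow> r = q)"
proof -
  define A where "A = {q. sublinear q \<and> (\<forall>x. q x \<le> p x) \<and> (\<forall>y\<in>Y. g y \<le> q y)}"
  define R where "R = (\<lambda>q r :: 'a \<Rightarrow> real. r \<le> q)"
  have pA: "p \<in> A" using p g by (auto simp: A_def)
  have "\<exists>m\<in>A. \<forall>a\<in>A. R m a \<longrightarrow> a = m"
  proof (rule predicate_Zorn)
    show "partial_order_on A (relation_of R A)"
      by (auto simp: partial_order_on_def preorder_on_def refl_on_def trans_def antisym_def
          relation_of_def R_def intro: order.trans)
  next
    fix C assume C: "C \<in> Chains (relation_of R A)"
    then have CA: "C \<subseteq> A" and ch: "\<forall>q\<in>C. \<forall>r\<in>C. q \<le> r \<or> r \<le> q"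
      by (auto simp: Chains_def relation_of_def R_def)
    show "\<exists>u\<in>A. \<forall>a\<in>C. R a u"
    proof (cases "C = {}")
      case True
      then show ?thesis using pA by auto
    next
      case ne: False
      have sub: "\<forall>q\<in>C. sublinear q" and le: "\<forall>q\<in>C. \<forall>x. q x \<le> p x"
        using CA by (auto simp: A_def)
      note I = sublinear_Inf_chain[OF ne sub le ch]
      have "(\<lambda>x. INF q\<in>C. q x) \<in> A"
      proof -
        obtain q0 where q0: "q0 \<in> C" using ne by blast
        have "(INF q\<in>C. q x) \<le> p x" for x
          using I(2)[OF q0, of x] bspec[OF le q0] by (blast intro: order.trans)
        moreover have "g y \<le> (INF q\<in>C. q y)" if "y \<in> Y" for y
          using CA that by (intro cINF_greatest[OF ne]) (auto simp: A_def)
        ultimately show ?thesis using I(1) by (auto simp: A_def)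
      qed
      moreover have "\<forall>a\<in>C. R a (\<lambda>x. INF q\<in>C. q x)"
        using I(2) by (auto simp: R_def le_fun_def)
      ultimately show ?thesis by blast
    qed
  qed
  then obtain q where q: "q \<in> A" "\<And>a. a \<in> A \<Longrightarrow> a \<le> q \<Longrightarrow> a = q"
    by (auto simp: R_def)
  have "r = q" if "sublinear r" "\<forall>x. r x \<le> q x" "\<forall>y\<in>Y. g y \<le> r y" for r
  proof (rule q(2))
    show "r \<in> A" using q(1) that by (auto simp: A_def intro: order.trans)
  qed (use that in \<open>auto simp: le_fun_def\<close>)
  then show ?thesis using q(1) by (auto simp: A_def)
qed

text \<open>An infimal convolution of \<open>p\<close> with the cone \<open>K\<close>. A pair
  \<open>(h, s)\<close> encodes the demand \<open>L h \<le> s\<close>: a linear \<open>L\<close>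
  below the result meets it, as \<open>v = h\<close> shows, and the pair \<open>(0, 0)\<close> gives
  \<open>L \<le> p\<close>. The assumption on \<open>s + p (- h)\<close> is the consistency of the
  demands with \<open>p\<close>; it keeps the infimum finite.\<close>

lemma sublinear_inf_conv:
  assumes p: "sublinear p" and K0: "(0, 0) \<in> K"
    and Kadd': "\<forall>h s h' s'. (h, s) \<in> K \<longrightarrow> (h', s') \<in> K \<longrightarrow> (h + h', s + s') \<in> K"
    and Kscale': "\<forall>t h s. 0 < t \<longrightarrow> (h, s) \<in> K \<longrightarrow> (t *\<^sub>R h, t * s) \<in> K"
    and low': "\<forall>h s. (h, s) \<in> K \<longrightarrow> 0 \<le> s + p (- h)"
  shows "sublinear (\<lambda>v. INF (h, s)\<in>K. s + p (v - h))"
    "\<And>h s v. (h, s) \<in> K \<Longrightarrow> (INF (h, s)\<in>K. s + p (v - h)) \<le> s + p (v - h)"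
proof -
  note Kadd = Kadd'[rule_format] and Kscale = Kscale'[rule_format] and low = low'[rule_format]
  let ?q = "\<lambda>v. INF (h, s)\<in>K. s + p (v - h)"
  have ne: "K \<noteq> {}" using K0 by auto
  have bdd: "bdd_below ((\<lambda>(h, s). s + p (v - h)) ` K)" for v
  proof (rule bdd_belowI2[where m = "- p (- v)"], clarsimp)
    fix h s assume "(h, s) \<in> K"
    from low[OF this] sublinear_add[OF p, of "v - h" "- v"]
    show "- p (- v) \<le> s + p (v - h)" by simp
  qed
  show le: "?q v \<le> s + p (v - h)" if "(h, s) \<in> K" for h s v
    using cINF_lower[OF bdd that, of v] by simp
  have approx: "\<exists>h s. (h, s) \<in> K \<and> s + p (v - h) < a" if "?q v < a" for v a
    using that cINF_less_iff[OF ne bdd, of v a] by auto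
  show "sublinear ?q"
  proof (rule sublinearI)
    fix x y
    show "?q (x + y) \<le> ?q x + ?q y"
    proof (rule field_le_epsilon)
      fix e :: real assume e: "0 < e"
      obtain h s where 1: "(h, s) \<in> K" "s + p (x - h) < ?q x + e/2"
        using approx[of x "?q x + e/2"] e by auto
      obtain h' s' where 2: "(h', s') \<in> K" "s' + p (y - h') < ?q y + e/2"
        using approx[of y "?q y + e/2"] e by auto
      have "?q (x + y) \<le> (s + s') + p ((x + y) - (h + h'))"
        by (rule le[OF Kadd[OF 1(1) 2(1)]])
      also have "\<dots> \<le> (s + s') + (p (x - h) + p (y - h'))"
        using sublinear_add[OF p, of "x - h" "y - h'"] by (simp add: algebra_simps)
      finally show "?q (x + y) \<le> ?q x + ?q y + e" using 1 2 by linarith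
    qed
  next
    fix t :: real and x assume t: "0 < t"
    have "inverse t * ?q (t *\<^sub>R x) \<le> ?q x"
    proof (rule cINF_greatest[OF ne], clarsimp)
      fix h s assume "(h, s) \<in> K"
      from le[OF Kscale[OF t this], of "t *\<^sub>R x"]
      have "?q (t *\<^sub>R x) \<le> t * s + t * p (x - h)"
        using sublinear_scale[OF p, of t "x - h"] t by (simp add: algebra_simps)
      then show "inverse t * ?q (t *\<^sub>R x) \<le> s + p (x - h)"
        using t by (simp add: field_simps)
    qed
    then show "?q (t *\<^sub>R x) \<le> t * ?q x" using t by (simp add: field_simps)
  next
    show "?q 0 = 0"
    proof (rule antisym)
      show "?q 0 \<le> 0" using le[OF K0, of 0] sublinear_zero[OF p] by simp
      show "0 \<le> ?q 0" using low by (intro cINF_greatest[OF ne]) auto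
    qed
  qed
qed

text \<open>A minimal sublinear \<open>q\<close> is linear: convolving it with the ray through
  \<open>(- v, - q v)\<close> can only lower it, so by minimality changes nothing, and the
  inequality at that generator reads \<open>q z \<le> q (z + v) - q v\<close>. This is
  superadditivity.\<close>

lemma sublinear_ge_linear:
  fixes p :: "'a::real_vector \<Rightarrow> real"
  assumes p: "sublinear p"
  obtains L where "linear L" "\<And>x. L x \<le> p x"
proof -
  obtain q where q: "sublinear q" "\<And>x. q x \<le> p x"
    and min: "\<And>r. sublinear r \<Longrightarrow> \<forall>x. r x \<le> q x \<Longrightarrow> r = q"
    using minimal_sublinear[OF p, of "{}" "\<lambda>_. 0"] by (metis empty_iff)
  have sup: "q z + q v \<le> q (z + v)" for z v
  proof -
    define K where "K = {(- (t *\<^sub>R v), - (t * q v)) | t. 0 \<le> t}"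
    have K0: "(0, 0) \<in> K" unfolding K_def by (auto intro: exI[of _ 0])
    have K1: "(- v, - q v) \<in> K" unfolding K_def by (auto intro: exI[of _ 1])
    have Kadd: "(h + h', s + s') \<in> K" if "(h, s) \<in> K" "(h', s') \<in> K" for h s h' s'
    proof -
      obtain t t' where "h = - (t *\<^sub>R v)" "s = - (t * q v)" "0 \<le> t"
        "h' = - (t' *\<^sub>R v)" "s' = - (t' * q v)" "0 \<le> t'"
        using \<open>(h, s) \<in> K\<close> \<open>(h', s') \<in> K\<close> unfolding K_def by auto
      then show ?thesis unfolding K_def
        by (auto intro!: exI[of _ "t + t'"] simp: algebra_simps)
    qed
    have Ksc: "(t *\<^sub>R h, t * s) \<in> K" if "0 < t" "(h, s) \<in> K" for t h s
    proof -
      obtain t' where "h = - (t' *\<^sub>R v)" "s = - (t' * q v)" "0 \<le> t'"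
        using \<open>(h, s) \<in> K\<close> unfolding K_def by auto
      then show ?thesis unfolding K_def using that(1)
        by (auto intro!: exI[of _ "t * t'"])
    qed
    have low: "0 \<le> s + q (- h)" if "(h, s) \<in> K" for h s
      using that sublinear_scale[OF q(1)] unfolding K_def by auto
    have I: "sublinear (\<lambda>v. INF (h, s)\<in>K. s + q (v - h))"
    "\<And>h s v. (h, s) \<in> K \<Longrightarrow> (INF (h, s)\<in>K. s + q (v - h)) \<le> s + q (v - h)"
    using Kadd Ksc low by (intro sublinear_inf_conv[OF q(1) K0]; blast)+
    have "(\<lambda>z. INF (h, s)\<in>K. s + q (z - h)) = q"
    proof (rule min[OF I(1)], rule allI)
      fix x show "(INF (h, s)\<in>K. s + q (x - h)) \<le> q x"
        using I(2)[OF K0, of x] by simp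
    qed
    then have "(INF (h, s)\<in>K. s + q (z - h)) = q z" by (rule fun_cong)
    with I(2)[OF K1, of z] show ?thesis by simp
  qed
  have add: "q (x + y) = q x + q y" for x y
    using sup[of x y] sublinear_add[OF q(1), of x y] by simp
  have neg: "q (- x) = - q x" for x
    using add[of x "- x"] sublinear_zero[OF q(1)] by simp
  have "linear q"
  proof (rule linearI)
    fix t x show "q (t *\<^sub>R x) = t *\<^sub>R q x"
    proof (cases "0 \<le> t")
      case True
      then show ?thesis by (simp add: sublinear_scale[OF q(1)])
    next
      case False
      then have "q ((- t) *\<^sub>R x) = (- t) * q x" by (intro sublinear_scale[OF q(1)]) simp
      then show ?thesis using neg[of "t *\<^sub>R x"] by simp
    qed
  qed (rule add)
  then show thesis using q(2) by (rule that)
qed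

text \<open>The demands form the graph of \<open>g\<close>. They give \<open>L \<le> g\<close> on
  \<open>Y\<close>; the same inequality at \<open>- y\<close> turns this into equality.\<close>

lemma hahn_banach_dominated:
  fixes p :: "'a::real_vector \<Rightarrow> real"
  assumes p: "sublinear p" and Y: "subspace Y"
    and gadd: "\<And>x y. x \<in> Y \<Longrightarrow> y \<in> Y \<Longrightarrow> g (x + y) = g x + g y"
    and gscale: "\<And>t x. x \<in> Y \<Longrightarrow> g (t *\<^sub>R x) = t * g x"
    and le: "\<And>y. y \<in> Y \<Longrightarrow> g y \<le> p y"
  obtains L where "linear L" "\<And>x. L x \<le> p x" "\<And>y. y \<in> Y \<Longrightarrow> L y = g y"
proof -
  define K where "K = (\<lambda>y. (y, g y)) ` Y"
  have g0: "g 0 = 0" using gscale[of 0 0] subspace_0[OF Y] by simp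
  have gneg: "g (- y) = - g y" if "y \<in> Y" for y using gscale[OF that, of "- 1"] by simp
  have K0: "(0, 0) \<in> K" using g0 subspace_0[OF Y] by (force simp: K_def)
  have Kadd: "(h + h', s + s') \<in> K" if "(h, s) \<in> K" "(h', s') \<in> K" for h s h' s'
    using that gadd subspace_add[OF Y] by (auto simp: K_def image_iff)
  have Ksc: "(t *\<^sub>R h, t * s) \<in> K" if "0 < t" "(h, s) \<in> K" for t h s
    using that gscale subspace_scale[OF Y] by (auto simp: K_def image_iff)
  have low: "0 \<le> s + p (- h)" if "(h, s) \<in> K" for h s
    using that le[of "- h"] gneg subspace_neg[OF Y] by (auto simp: K_def)
  have I: "sublinear (\<lambda>v. INF (h, s)\<in>K. s + p (v - h))"
    "\<And>h s v. (h, s) \<in> K \<Longrightarrow> (INF (h, s)\<in>K. s + p (v - h)) \<le> s + p (v - h)"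
    using Kadd Ksc low by (intro sublinear_inf_conv[OF p K0]; blast)+
  obtain L where L: "linear L" "\<And>x. L x \<le> (INF (h, s)\<in>K. s + p (x - h))"
    using sublinear_ge_linear[OF I(1)] by blast
  have Lle: "L y \<le> g y" if "y \<in> Y" for y
    using L(2)[of y] I(2)[of y "g y" y] that sublinear_zero[OF p] by (force simp: K_def)
  show thesis
  proof (rule that[OF L(1)])
    show "L x \<le> p x" for x
      using L(2)[of x] I(2)[OF K0, of x] by simp
    show "L y = g y" if "y \<in> Y" for y
      using Lle[OF that] Lle[OF subspace_neg[OF Y that]] gneg[OF that] linear_neg[OF L(1), of y] by linarith
  qed
qed

section \<open>Bounded functionals subject to families of linear inequalities\<close>

lemma linear_le_norm_blinfun:
  fixes L :: "'a::real_normed_vector \<Rightarrow> real"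
  assumes L: "linear L" and le: "\<And>x. L x \<le> c * norm x" and c: "0 \<le> c"
  obtains l :: "'a \<Rightarrow>\<^sub>L real" where "norm l \<le> c" "\<And>x. l x = L x"
proof -
  have abs: "norm (L x) \<le> norm x * c" for x
    using le[of x] le[of "- x"] linear_neg[OF L, of x] by (simp add: abs_le_iff mult.commute)
  then have "bounded_linear L"
    using L by (intro bounded_linear_intro[of L c]) (auto simp: linear_add linear_scale)
  then have eq: "Blinfun L x = L x" for x by (simp add: bounded_linear_Blinfun_apply)
  show thesis
  proof (rule that)
    show "Blinfun L x = L x" for x by (rule eq)
    show "norm (Blinfun L) \<le> c"
      using abs by (intro norm_blinfun_bound c) (simp add: eq mult.commute)
  qed
qed

lemma blinfun_le_norm: "norm l \<le> c \<Longrightarrow> \<bar>blinfun_apply l x\<bar> \<le> c * norm x"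
  for l :: "'a::real_normed_vector \<Rightarrow>\<^sub>L real"
  using norm_blinfun[of l x] mult_right_mono[of "norm l" c "norm x"] by simp

lemma tendsto_floor_div:
  assumes "0 \<le> (t::real)"
  shows "(\<lambda>n. real (nat \<lfloor>real n * t\<rfloor>) / real n) \<longlonglongrightarrow> t"
proof (rule tendsto_sandwich)
  have "t - 1 / real n \<le> real (nat \<lfloor>real n * t\<rfloor>) / real n" if "0 < n" for n
  proof -
    have "real n * t - 1 \<le> real (nat \<lfloor>real n * t\<rfloor>)" by linarith
    then have "(real n * t - 1) / real n \<le> real (nat \<lfloor>real n * t\<rfloor>) / real n"
      by (rule divide_right_mono) simp
    then show ?thesis using that by (simp add: diff_divide_distrib)
  qed
  then show "\<forall>\<^sub>F n in sequentially. t - 1 / real n \<le> real (nat \<lfloor>real n * t\<rfloor>) / real n"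
    by (rule eventually_mono[OF eventually_gt_at_top[of 0]])
  have "real (nat \<lfloor>real n * t\<rfloor>) / real n \<le> t" if "0 < n" for n
  proof -
    have "0 \<le> real n * t" using assms by simp
    then have "real (nat \<lfloor>real n * t\<rfloor>) \<le> real n * t" by linarith
    then show ?thesis using that by (simp add: field_simps)
  qed
  then show "\<forall>\<^sub>F n in sequentially. real (nat \<lfloor>real n * t\<rfloor>) / real n \<le> t"
    by (rule eventually_mono[OF eventually_gt_at_top[of 0]])
  have "(\<lambda>n. t - 1 / real n) \<longlonglongrightarrow> t - 0"
    by (intro tendsto_intros lim_1_over_n)
  then show "(\<lambda>n. t - 1 / real n) \<longlonglongrightarrow> t" by simp
qed simp

text \<open>Lists carry natural-number multiplicities; passing to real weights is a limiting argument.\<close>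

lemma mazur_orlicz:
  fixes E :: "('a::real_normed_vector \<times> real) set"
  assumes c: "0 \<le> c"
    and E: "\<And>l. set l \<subseteq> E \<Longrightarrow> 0 \<le> sum_list (map snd l) + c * norm (sum_list (map fst l))"
  obtains x' :: "'a \<Rightarrow>\<^sub>L real" where "norm x' \<le> c" "\<And>h s. (h, s) \<in> E \<Longrightarrow> x' h \<le> s"
proof -
  define H where "H = (\<lambda>l::(real \<times> 'a \<times> real) list. \<Sum>(t, h, s)\<leftarrow>l. t *\<^sub>R h)"
  define S where "S = (\<lambda>l::(real \<times> 'a \<times> real) list. \<Sum>(t, h, s)\<leftarrow>l. t * s)"
  define P where "P = {l::(real \<times> 'a \<times> real) list. \<forall>(t, e)\<in>set l. 0 \<le> t \<and> e \<in> E}"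
  define K where "K = (\<lambda>l. (H l, S l)) ` P"
  have low: "0 \<le> S l + c * norm (H l)" if l: "l \<in> P" for l
  proof -
    define F where "F = (\<lambda>n (l::(real \<times> 'a \<times> real) list).
      concat (map (\<lambda>(t, e). replicate (nat \<lfloor>real n * t\<rfloor>) e) l))"
    have sub: "set (F n l) \<subseteq> E" for n using l by (auto simp: F_def P_def)
    have "(\<lambda>n. sum_list (map snd (F n l)) / real n) \<longlonglongrightarrow> S l" using l
    proof (induction l)
      case (Cons a l)
      obtain t h s where a: "a = (t, h, s)" by (cases a)
      have "(\<lambda>n. real (nat \<lfloor>real n * t\<rfloor>) / real n * s + sum_list (map snd (F n l)) / real n) \<longlonglongrightarrow> t * s + S l"
        using Cons a by (intro tendsto_intros tendsto_floor_div) (auto simp: P_def)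
      then show ?case by (simp add: a F_def S_def sum_list_replicate add_divide_distrib)
    qed (simp add: F_def S_def)
    moreover have "(\<lambda>n. sum_list (map fst (F n l)) /\<^sub>R real n) \<longlonglongrightarrow> H l" using l
    proof (induction l)
      case (Cons a l)
      obtain t h s where a: "a = (t, h, s)" by (cases a)
      have rep: "sum_list (replicate m h) = real m *\<^sub>R h" for m
        by (induction m) (auto simp: algebra_simps)
      have "(\<lambda>n. (real (nat \<lfloor>real n * t\<rfloor>) / real n) *\<^sub>R h + sum_list (map fst (F n l)) /\<^sub>R real n) \<longlonglongrightarrow> t *\<^sub>R h + H l"
        using Cons a by (intro tendsto_intros tendsto_floor_div) (auto simp: P_def)
      then show ?case by (simp add: a F_def H_def rep scaleR_add_right divide_inverse mult.commute)
    qed (simp add: F_def H_def)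
    ultimately have "(\<lambda>n. sum_list (map snd (F n l)) / real n + c * norm (sum_list (map fst (F n l)) /\<^sub>R real n))
        \<longlonglongrightarrow> S l + c * norm (H l)"
      by (intro tendsto_intros)
    moreover have "0 \<le> sum_list (map snd (F n l)) / real n + c * norm (sum_list (map fst (F n l)) /\<^sub>R real n)" for n
    proof -
      have "0 \<le> (sum_list (map snd (F n l)) + c * norm (sum_list (map fst (F n l)))) / real n"
        using E[OF sub] by simp
      then show ?thesis by (simp add: divide_inverse distrib_left mult_ac)
    qed
    ultimately show ?thesis by (intro LIMSEQ_le_const[where x = "S l + c * norm (H l)"]) auto
  qed
  have K0: "(0, 0) \<in> K"
    by (auto simp: K_def P_def H_def S_def image_iff intro!: exI[of _ "[]"])
  have Kadd: "(h + h', s + s') \<in> K" if "(h, s) \<in> K" "(h', s') \<in> K" for h s h' s'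
  proof -
    obtain l l' where "l \<in> P" "l' \<in> P" "h = H l" "s = S l" "h' = H l'" "s' = S l'"
      using \<open>(h, s) \<in> K\<close> \<open>(h', s') \<in> K\<close> by (auto simp: K_def)
    then show ?thesis
      by (auto simp: K_def P_def H_def S_def image_iff intro!: exI[of _ "l @ l'"])
  qed
  have Ksc: "(r *\<^sub>R h, r * s) \<in> K" if "0 < r" "(h, s) \<in> K" for r h s
  proof -
    obtain l where l: "l \<in> P" "h = H l" "s = S l"
      using \<open>(h, s) \<in> K\<close> by (auto simp: K_def)
    let ?l = "map (\<lambda>(t, e). (r * t, e)) l"
    have "H ?l = r *\<^sub>R H l" by (induction l) (auto simp: H_def scaleR_add_right)
    moreover have "S ?l = r * S l" by (induction l) (auto simp: S_def distrib_left)
    moreover have "?l \<in> P" using l(1) that(1) by (fastforce simp: P_def)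
    ultimately show ?thesis using l by (auto simp: K_def image_iff simp del: map_map intro!: bexI[of _ ?l])
  qed
  have Klow: "0 \<le> s + c * norm (- h)" if "(h, s) \<in> K" for h s
    using that low by (auto simp: K_def)
  have I: "sublinear (\<lambda>v. INF (h, s)\<in>K. s + c * norm (v - h))"
    "\<And>h s v. (h, s) \<in> K \<Longrightarrow> (INF (h, s)\<in>K. s + c * norm (v - h)) \<le> s + c * norm (v - h)"
    using Kadd Ksc Klow by (intro sublinear_inf_conv[OF sublinear_norm[OF c] K0]; blast)+
  obtain L where L: "linear L" "\<And>x. L x \<le> (INF (h, s)\<in>K. s + c * norm (x - h))"
    using sublinear_ge_linear[OF I(1)] by blast
  have "L x \<le> c * norm x" for x using L(2)[of x] I(2)[OF K0, of x] by simp
  then obtain x' :: "'a \<Rightarrow>\<^sub>L real" where x': "norm x' \<le> c" "\<And>x. x' x = L x"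
    using linear_le_norm_blinfun[OF L(1) _ c] by blast
  show thesis
  proof (rule that[OF x'(1)])
    fix h s assume "(h, s) \<in> E"
    then have "[(1, h, s)] \<in> P" by (simp add: P_def)
    then have "(h, s) \<in> K" by (force simp: K_def H_def S_def)
    from I(2)[OF this, of h] L(2)[of h] show "x' h \<le> s" by (simp add: x'(2))
  qed
qed

section \<open>Separable subspaces of Asplund spaces\<close>

lemma sublinear_diff_le:
  assumes "sublinear q" "\<And>x. q x \<le> c * norm x"
  shows "\<bar>q x - q y\<bar> \<le> c * norm (x - y)"
  using sublinear_add[OF assms(1), of "x - y" y] sublinear_add[OF assms(1), of "y - x" x]
    assms(2)[of "x - y"] assms(2)[of "y - x"] by (simp add: norm_minus_commute)

lemma asplund_sublinear_differentiable:
  fixes q :: "'a::real_normed_vector \<Rightarrow> real"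
  assumes "asplund TYPE('a)" and q: "sublinear q" and le: "\<And>x. q x \<le> c * norm x"
  obtains x where "q differentiable (at x)"
proof -
  have "continuous_on UNIV q"
  proof (rule continuous_onI)
    fix x :: 'a and e :: real assume e: "0 < e"
    have "dist (q y) (q x) \<le> e" if "dist y x < e / (\<bar>c\<bar> + 1)" for y
    proof -
      have "dist (q y) (q x) \<le> \<bar>c\<bar> * norm (y - x)"
        using sublinear_diff_le[OF q le, of y x] mult_right_mono[OF abs_ge_self norm_ge_zero, of c "y - x"]
        by (simp add: dist_real_def)
      also have "\<dots> \<le> (\<bar>c\<bar> + 1) * norm (y - x)" by (intro mult_right_mono) auto
      also have "\<dots> \<le> e"
        using that by (simp add: dist_norm field_simps)
      finally show ?thesis .
    qed
    then show "\<exists>d>0. \<forall>y\<in>UNIV. dist y x < d \<longrightarrow> dist (q y) (q x) \<le> e"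
      using e by (intro exI[of _ "e / (\<bar>c\<bar> + 1)"]) auto
  qed
  moreover have "convex_on UNIV q"
  proof (rule convex_onI)
    fix t x y assume "0 < t" "t < (1::real)"
    then show "q ((1 - t) *\<^sub>R x + t *\<^sub>R y) \<le> (1 - t) * q x + t * q y"
      using sublinear_add[OF q, of "(1 - t) *\<^sub>R x" "t *\<^sub>R y"] by (simp add: sublinear_scale[OF q])
  qed simp
  ultimately obtain D where "UNIV \<subseteq> closure D" "\<forall>x\<in>D. q differentiable (at x)"
    using assms(1) unfolding asplund_def by (metis convex_UNIV open_UNIV)
  moreover from this have "D \<noteq> {}" by auto
  ultimately show thesis using that by blast
qed

text \<open>One half of Smulian's test. A functional below \<open>q\<close> that almost attains
  \<open>q x\<close> is squeezed: its value at \<open>k\<close> is at most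
  \<open>q (x + k) - q x\<close> plus the defect, and the derivative \<open>D\<close> controls this
  difference on a small sphere. So all such functionals are close to \<open>D\<close> in
  norm.\<close>

lemma differentiable_small_slice:
  fixes q :: "'a::real_normed_vector \<Rightarrow> real"
  assumes diff: "q differentiable (at x)" and e: "0 < e"
  obtains t where "0 < t"
    "\<And>u w h. linear u \<Longrightarrow> linear w \<Longrightarrow> (\<And>z. u z \<le> q z) \<Longrightarrow> (\<And>z. w z \<le> q z) \<Longrightarrow>
      q x - t < u x \<Longrightarrow> q x - t < w x \<Longrightarrow> \<bar>u h - w h\<bar> \<le> e * norm h"
proof -
  obtain D where D: "(q has_derivative D) (at x)" using diff by (auto simp: differentiable_def)
  then have lin: "linear D" by (rule has_derivative_linear)
  obtain r where r: "0 < r"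
    and bound: "\<And>y. norm (y - x) < r \<Longrightarrow> norm (q y - q x - D (y - x)) \<le> e / 4 * norm (y - x)"
    using D e unfolding has_derivative_at_alt by (meson divide_pos_pos zero_less_numeral)
  \<comment> \<open>On the sphere of radius \<open>r / 2\<close> the bound on the linearisation
    error and the defect \<open>t\<close> coincide and add up to
    \<open>e / 2 * norm k\<close>.\<close>
  define t where "t = e / 4 * (r / 2)"
  have t: "0 < t" using e r by (simp add: t_def)
  have key: "\<bar>u h - D h\<bar> \<le> e / 2 * norm h"
    if u: "linear u" "\<And>z. u z \<le> q z" "q x - t < u x" for u h
  proof -
    have le: "u k - D k \<le> e / 2 * norm k" if k: "norm k = r / 2" for k
    proof -
      have "u k = u (x + k) - u x" by (simp add: linear_add[OF u(1)])
      also have "\<dots> \<le> q (x + k) - q x + t" using u(2)[of "x + k"] u(3) by linarith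
      also have "\<dots> \<le> D k + e / 4 * norm k + t"
      proof -
        have "norm k < r" using k r by simp
        then have "\<bar>q (x + k) - q x - D k\<bar> \<le> e / 4 * norm k" using bound[of "x + k"] by simp
        then show ?thesis by linarith
      qed
      also have "t = e / 4 * norm k" using k by (simp add: t_def)
      finally show ?thesis by linarith
    qed
    have le2: "u k - D k \<le> e / 2 * norm k" for k
    proof (cases "k = 0")
      case False
      define s where "s = r / 2 / norm k"
      have s: "0 < s" using False r by (simp add: s_def)
      have "norm (s *\<^sub>R k) = r / 2" using False r by (simp add: s_def)
      from le[OF this] have "s * (u k - D k) \<le> s * (e / 2 * norm k)"
        using s by (simp add: linear_scale[OF u(1)] linear_scale[OF lin] algebra_simps)
      then show ?thesis using s by simp
    qed (simp add: linear_0[OF u(1)] linear_0[OF lin])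
    show ?thesis
      using le2[of h] le2[of "- h"] unfolding linear_neg[OF u(1)] linear_neg[OF lin] norm_minus_cancel by linarith
  qed
  show thesis
  proof (rule that[OF t])
    fix u w h
    assume "linear u" "linear w" "\<And>z. u z \<le> q z" "\<And>z. w z \<le> q z" "q x - t < u x" "q x - t < w x"
    from key[OF this(1,3,5), of h] key[OF this(2,4,6), of h]
    show "\<bar>u h - w h\<bar> \<le> e * norm h" by linarith
  qed
qed

text \<open>A Cantor-Bendixson argument with slices in place of neighbourhoods: only countably many
  slices have a direction in \<open>C\<close> and a rational level, so discarding all countable ones
  removes a countable part of \<open>A\<close>. A slice by a direction in \<open>Y\<close> that
  still holds a point \<open>a\<close> contains an uncountable one of these, which survives the
  removal of \<open>a\<close> and of the discarded part.\<close>

lemma uncountable_dual_halfspaces: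
  fixes A :: "('a::real_normed_vector \<Rightarrow>\<^sub>L real) set"
  assumes A: "uncountable A" and bound: "\<And>a. a \<in> A \<Longrightarrow> norm a \<le> c"
    and C: "countable C" and Y: "Y \<subseteq> closure C" and c: "0 < c"
  obtains A' where "A' \<subseteq> A" "A' \<noteq> {}"
    "\<And>a y s. a \<in> A' \<Longrightarrow> y \<in> Y \<Longrightarrow> s < blinfun_apply a y \<Longrightarrow> \<exists>b\<in>A'. b \<noteq> a \<and> s < blinfun_apply b y"
proof -
  define H where "H = (\<lambda>(j, s). {b \<in> A. s < blinfun_apply b j})"
  define Z where "Z = {js \<in> C \<times> \<rat>. countable (H js)}"
  have "countable Z" unfolding Z_def by (rule countable_subset[of _ "C \<times> \<rat>"]) (auto intro: C countable_rat)
  then have cZ: "countable (\<Union>(H ` Z))" by (auto simp: Z_def)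
  define A' where "A' = A - \<Union>(H ` Z)"
  have unc: "uncountable A'" unfolding A'_def using uncountable_minus_countable[OF A cZ] .
  show thesis
  proof (rule that)
    show "A' \<subseteq> A" by (auto simp: A'_def)
    show "A' \<noteq> {}" using unc by auto
    fix a y s assume a: "a \<in> A'" and y: "y \<in> Y" and s: "s < blinfun_apply a y"
    \<comment> \<open>Replacing \<open>y\<close> by \<open>j\<close> changes every value by at most
      \<open>c * d\<close>, a third of the gap. One third is lost on the way to \<open>j\<close>,
      one on the way back, and the last leaves room for the rational level.\<close>
    define d where "d = (a y - s) / (3 * c)"
    have d: "0 < d" using s c by (simp add: d_def)
    obtain j where j: "j \<in> C" "dist j y < d"
      using y Y d closure_approachable by (metis subsetD)
    have near: "\<bar>blinfun_apply b y - blinfun_apply b j\<bar> \<le> c * d" if "b \<in> A" for b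
    proof -
      have "\<bar>blinfun_apply b (y - j)\<bar> \<le> c * norm (y - j)" by (rule blinfun_le_norm[OF bound[OF that]])
      also have "\<dots> \<le> c * d" using j c by (intro mult_left_mono) (auto simp: dist_norm norm_minus_commute)
      finally show ?thesis by (simp add: blinfun.diff_right)
    qed
    have cd: "3 * (c * d) = a y - s" using c by (simp add: d_def)
    have aA: "a \<in> A" using a by (auto simp: A'_def)
    have "s + c * d < a j" using near[OF aA] cd d c by (smt (verit) mult_pos_pos)
    then obtain s' where s': "s' \<in> \<rat>" "s + c * d < s'" "s' < a j"
      using Rats_dense_in_real by blast
    have "a \<in> H (j, s')" using aA s' by (auto simp: H_def)
    then have "(j, s') \<notin> Z" using a by (auto simp: A'_def)
    then have "uncountable (H (j, s'))" using j s' by (auto simp: Z_def)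
    then have "uncountable (H (j, s') - (\<Union>(H ` Z) \<union> {a}))"
      by (intro uncountable_minus_countable) (use cZ in auto)
    then obtain b where b: "b \<in> H (j, s')" "b \<notin> \<Union>(H ` Z)" "b \<noteq> a"
      by (metis (no_types, lifting) Diff_iff UnCI all_not_in_conv countable_empty singletonI)
    then have "b \<in> A" "s' < b j" by (auto simp: H_def)
    then have "b \<in> A'" "s < b y" using b near[of b] s' by (auto simp: A'_def)
    then show "\<exists>b\<in>A'. b \<noteq> a \<and> s < blinfun_apply b y" using b by auto
  qed
qed

lemma sublinear_SUP_linear:
  fixes q :: "'a::real_vector \<Rightarrow> real"
  assumes ne: "U \<noteq> {}" and lin: "\<forall>u\<in>U. linear u" and le: "\<forall>u\<in>U. \<forall>z. u z \<le> q z"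
  shows "sublinear (\<lambda>z. SUP u\<in>U. u z)" "\<And>u z. u \<in> U \<Longrightarrow> u z \<le> (SUP u\<in>U. u z)"
    "\<And>z. (SUP u\<in>U. u z) \<le> q z"
proof -
  note U = bspec[OF lin] spec[OF bspec[OF le]]
  have bdd: "bdd_above ((\<lambda>u. u z) ` U)" for z by (rule bdd_aboveI2) (rule U(2))
  show up: "u z \<le> (SUP u\<in>U. u z)" if "u \<in> U" for u z by (rule cSUP_upper[OF that bdd])
  show "(SUP u\<in>U. u z) \<le> q z" for z by (rule cSUP_least[OF ne]) (rule U(2))
  show "sublinear (\<lambda>z. SUP u\<in>U. u z)"
  proof (rule sublinearI)
    show "(SUP u\<in>U. u (x + y)) \<le> (SUP u\<in>U. u x) + (SUP u\<in>U. u y)" for x y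
      using up by (intro cSUP_least[OF ne]) (auto simp: linear_add[OF U(1)] intro: add_mono)
    show "(SUP u\<in>U. u (t *\<^sub>R x)) \<le> t * (SUP u\<in>U. u x)" if "0 < t" for t x
      using up that by (intro cSUP_least[OF ne]) (auto simp: linear_scale[OF U(1)] intro: mult_left_mono)
    have "(\<lambda>u. u 0) ` U = {0}" using ne linear_0[OF U(1)] by force
    then show "(SUP u\<in>U. u 0) = 0" by simp
  qed
qed

text \<open>At a differentiability point \<open>x\<close> of the minimal \<open>q\<close>, the
  functionals below \<open>q\<close> that nearly attain \<open>q x\<close> differ by at most
  \<open>e\<close>. The supremum of the others, collected in \<open>U\<close>, is strictly below
  \<open>q\<close> at \<open>x\<close>; by minimality it fails to dominate \<open>g\<close>
  somewhere on \<open>Y\<close>. There two elements of \<open>A'\<close> exceed it, so extensions of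
  both lie in the small slice, against their separation.\<close>

lemma asplund_separated_countable:
  fixes A :: "('a::real_normed_vector \<Rightarrow>\<^sub>L real) set"
  assumes asp: "asplund TYPE('a)" and Y: "subspace Y" "Y \<subseteq> closure C" "countable C"
    and c: "0 < c" and bound: "\<And>a. a \<in> A \<Longrightarrow> norm a \<le> c" and e: "0 < e"
    and sep: "\<And>a b. a \<in> A \<Longrightarrow> b \<in> A \<Longrightarrow> \<forall>y\<in>Y. \<bar>blinfun_apply a y - blinfun_apply b y\<bar> \<le> e * norm y \<Longrightarrow> a = b"
  shows "countable A"
proof (rule ccontr)
  assume "uncountable A"
  then obtain A' where A': "A' \<subseteq> A" "A' \<noteq> {}"
    and two: "\<And>a y s. a \<in> A' \<Longrightarrow> y \<in> Y \<Longrightarrow> s < blinfun_apply a y \<Longrightarrow> \<exists>b\<in>A'. b \<noteq> a \<and> s < blinfun_apply b y"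
    using uncountable_dual_halfspaces[OF _ bound Y(3,2) c] by blast
  define g where "g = (\<lambda>y. SUP a\<in>A'. blinfun_apply a y)"
  have ale: "blinfun_apply a y \<le> c * norm y" if "a \<in> A'" for a y
    using blinfun_le_norm[OF bound, of a y] that A' by fastforce
  have bdd: "bdd_above ((\<lambda>a. blinfun_apply a y) ` A')" for y by (rule bdd_aboveI2) (rule ale)
  have ag: "blinfun_apply a y \<le> g y" if "a \<in> A'" for a y
    unfolding g_def by (rule cSUP_upper[OF that bdd])
  have gle: "g y \<le> c * norm y" for y unfolding g_def by (rule cSUP_least[OF A'(2)]) (rule ale)
  obtain q where q: "sublinear q" "\<And>x. q x \<le> c * norm x" "\<And>y. y \<in> Y \<Longrightarrow> g y \<le> q y"
    and min: "\<And>r. sublinear r \<Longrightarrow> \<forall>x. r x \<le> q x \<Longrightarrow> \<forall>y\<in>Y. g y \<le> r y \<Longrightarrow> r = q"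
    using minimal_sublinear[OF sublinear_norm[of c], of Y g] c gle by (metis less_imp_le)
  obtain x where "q differentiable (at x)"
    using asplund_sublinear_differentiable[OF asp q(1,2)] by blast
  then obtain t where t: "0 < t"
    and slice: "\<And>u w h. linear u \<Longrightarrow> linear w \<Longrightarrow> (\<And>z. u z \<le> q z) \<Longrightarrow> (\<And>z. w z \<le> q z) \<Longrightarrow>
      q x - t < u x \<Longrightarrow> q x - t < w x \<Longrightarrow> \<bar>u h - w h\<bar> \<le> e * norm h"
    using differentiable_small_slice[OF _ e] by blast
  \<comment> \<open>The functional \<open>a\<close> is known to lie below \<open>q\<close> only on
    \<open>Y\<close>, where \<open>g \<le> q\<close>; off \<open>Y\<close> it is replaced by another
    extension of its restriction.\<close>
  have ext: "\<exists>L. linear L \<and> (\<forall>z. L z \<le> q z) \<and> (\<forall>y\<in>Y. L y = blinfun_apply a y)" if "a \<in> A'" for a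
  proof -
    have "blinfun_apply a y \<le> q y" if "y \<in> Y" for y
      using ag[OF \<open>a \<in> A'\<close>, of y] q(3)[OF that] by linarith
    from hahn_banach_dominated[OF q(1) Y(1), of "blinfun_apply a", OF _ _ this]
    show ?thesis by (metis blinfun.add_right blinfun.scaleR_right real_scaleR_def)
  qed
  define U where "U = {u. linear u \<and> (\<forall>z. u z \<le> q z) \<and> u x \<le> q x - t}"
  have clash: False if y: "y \<in> Y" and a: "a \<in> A'" "s < blinfun_apply a y"
    and U: "\<And>u. u \<in> U \<Longrightarrow> u y \<le> s" for y a s
  proof -
    obtain b where b: "b \<in> A'" "b \<noteq> a" "s < blinfun_apply b y" using two[OF a(1) y a(2)] by blast
    obtain L where L: "linear L" "\<forall>z. L z \<le> q z" "\<forall>y\<in>Y. L y = blinfun_apply a y"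
      using ext[OF a(1)] by blast
    obtain M where M: "linear M" "\<forall>z. M z \<le> q z" "\<forall>y\<in>Y. M y = blinfun_apply b y"
      using ext[OF b(1)] by blast
    have "L \<notin> U" using U[of L] L(3) y a by auto
    then have Lx: "q x - t < L x" using L by (auto simp: U_def)
    have "M \<notin> U" using U[of M] M(3) y b by auto
    then have Mx: "q x - t < M x" using M by (auto simp: U_def)
    have "\<bar>L h - M h\<bar> \<le> e * norm h" for h
      using L M by (intro slice Lx Mx) auto
    then have "\<forall>y\<in>Y. \<bar>blinfun_apply a y - blinfun_apply b y\<bar> \<le> e * norm y"
      using L(3) M(3) by metis
    then have "a = b" using sep a(1) b(1) A'(1) by blast
    then show False using b by simp
  qed
  show False
  \<comment> \<open>A supremum over the empty set carries no information, so that case uses the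
    direction \<open>0\<close> with level \<open>- 1\<close>.\<close>
  proof (cases "U = {}")
    case True
    obtain a where "a \<in> A'" using A' by blast
    then show False using clash[of 0 a "-1"] True subspace_0[OF Y(1)] by simp
  next
    case False
    have "\<forall>u\<in>U. linear u" "\<forall>u\<in>U. \<forall>z. u z \<le> q z" by (auto simp: U_def)
    note S = sublinear_SUP_linear[OF False this]
    have "(SUP u\<in>U. u x) \<le> q x - t" by (rule cSUP_least[OF False]) (auto simp: U_def)
    then have "(\<lambda>z. SUP u\<in>U. u z) x \<noteq> q x" using t by simp
    then have "(\<lambda>z. SUP u\<in>U. u z) \<noteq> q" by (rule contrapos_nn) (rule fun_cong)
    then obtain y where y: "y \<in> Y" "(SUP u\<in>U. u y) < g y"
      using min[OF S(1)] S(3) by (meson not_le)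
    then obtain a where "a \<in> A'" "(SUP u\<in>U. u y) < blinfun_apply a y"
      unfolding g_def using less_cSUP_iff[OF A'(2) bdd] by blast
    then show False using clash[OF y(1)] S(2) by blast
  qed
qed

text \<open>Zorn's lemma gives maximal \<open>e\<close>-separated subsets of the dual ball; they are
  countable, and maximality makes each an \<open>e\<close>-net. Closeness is measured on
  \<open>Y\<close> alone, so the result expresses separability of the dual of
  \<open>Y\<close>.\<close>

lemma asplund_separable_dual:
  fixes Y C :: "'a::real_normed_vector set"
  assumes asp: "asplund TYPE('a)" and Y: "subspace Y" "Y \<subseteq> closure C" "countable C"
    and c: "0 < c"
  obtains D :: "('a \<Rightarrow>\<^sub>L real) set" where "countable D" "\<And>d. d \<in> D \<Longrightarrow> norm d \<le> c"
    "\<And>x' e. norm x' \<le> c \<Longrightarrow> 0 < e \<Longrightarrow> \<exists>d\<in>D. \<forall>y\<in>Y. \<bar>blinfun_apply x' y - blinfun_apply d y\<bar> \<le> e * norm y"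
proof -
  define close where "close = (\<lambda>e a b. \<forall>y\<in>Y. \<bar>blinfun_apply a y - blinfun_apply b y\<bar> \<le> e * norm y)"
  have "\<exists>A. countable A \<and> (\<forall>a\<in>A. norm a \<le> c) \<and> (\<forall>x'. norm x' \<le> c \<longrightarrow> (\<exists>a\<in>A. close e x' a))"
    if e: "0 < e" for e
  proof -
    define S where "S = {A. (\<forall>a\<in>A. norm a \<le> c) \<and> (\<forall>a\<in>A. \<forall>b\<in>A. close e a b \<longrightarrow> a = b)}"
    have "\<exists>M\<in>S. \<forall>X\<in>S. M \<subseteq> X \<longrightarrow> X = M"
    proof (rule subset_Zorn')
      fix \<C> assume ch: "subset.chain S \<C>"
      have "a = b" if "a \<in> \<Union>\<C>" "b \<in> \<Union>\<C>" "close e a b" for a b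
      proof -
        obtain X X' where X: "a \<in> X" "X \<in> \<C>" "b \<in> X'" "X' \<in> \<C>"
          using \<open>a \<in> \<Union>\<C>\<close> \<open>b \<in> \<Union>\<C>\<close> by blast
        then have "X \<subseteq> X' \<or> X' \<subseteq> X" "X \<in> S" "X' \<in> S" using ch by (auto simp: subset_chain_def)
        then obtain W where "W \<in> S" "a \<in> W" "b \<in> W" using X by blast
        then show ?thesis using \<open>close e a b\<close> by (auto simp: S_def)
      qed
      moreover have "norm a \<le> c" if "a \<in> \<Union>\<C>" for a
        using that ch by (auto simp: subset_chain_def S_def)
      ultimately show "\<Union>\<C> \<in> S" unfolding S_def by blast
    qed
    then obtain M where M: "M \<in> S" "\<And>X. X \<in> S \<Longrightarrow> M \<subseteq> X \<Longrightarrow> X = M" by blast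
    have "countable M"
      by (rule asplund_separated_countable[OF asp Y c _ e]) (use M(1) in \<open>auto simp: S_def close_def\<close>)
    moreover have "\<exists>a\<in>M. close e x' a" if x': "norm x' \<le> c" for x'
    proof (rule ccontr)
      assume no: "\<not> (\<exists>a\<in>M. close e x' a)"
      have sym: "close e a b \<longleftrightarrow> close e b a" for a b
        by (auto simp: close_def abs_minus_commute)
      have "insert x' M \<in> S" using M(1) x' no sym by (auto simp: S_def)
      then have "x' \<in> M" using M(2) by blast
      moreover have "close e x' x'" using e by (simp add: close_def)
      ultimately show False using no by blast
    qed
    ultimately show ?thesis using M(1) by (auto simp: S_def)
  qed
  then obtain A where A: "\<And>e. 0 < e \<Longrightarrow> countable (A e)" "\<And>e a. 0 < e \<Longrightarrow> a \<in> A e \<Longrightarrow> norm a \<le> c"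
    "\<And>e x'. 0 < e \<Longrightarrow> norm x' \<le> c \<Longrightarrow> \<exists>a\<in>A e. close e x' a"
    by metis
  show thesis
  proof (rule that[of "\<Union>n. A (inverse (real (Suc n)))"])
    show "countable (\<Union>n. A (inverse (real (Suc n))))" using A(1) by auto
    show "norm d \<le> c" if d: "d \<in> (\<Union>n. A (inverse (real (Suc n))))" for d
    proof -
      obtain n where "d \<in> A (inverse (real (Suc n)))" using d by blast
      from A(2)[OF _ this] show ?thesis by simp
    qed
    fix x' :: "'a \<Rightarrow>\<^sub>L real" and e :: real assume x': "norm x' \<le> c" and e: "0 < e"
    obtain n where n: "inverse (real (Suc n)) < e" using reals_Archimedean[OF e] by blast
    obtain d where d: "d \<in> A (inverse (real (Suc n)))" "close (inverse (real (Suc n))) x' d"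
      using A(3)[OF _ x', of "inverse (real (Suc n))"] by auto
    have "close e x' d"
      using d(2) n unfolding close_def by (meson less_imp_le mult_right_mono norm_ge_zero order.trans)
    then show "\<exists>d\<in>(\<Union>n. A (inverse (real (Suc n)))). \<forall>y\<in>Y. \<bar>blinfun_apply x' y - blinfun_apply d y\<bar> \<le> e * norm y"
      using d(1) by (auto simp: close_def)
  qed
qed

section \<open>Smooth approximation of the norm\<close>

text \<open>The dual norm of the restriction of \<open>u\<close> to \<open>Y\<close>; on functionals
  of the whole space it is only a seminorm.\<close>

definition norm_on :: "'a::real_normed_vector set \<Rightarrow> ('a \<Rightarrow>\<^sub>L real) \<Rightarrow> real" where
  "norm_on Y u = (SUP y\<in>Y \<inter> cball 0 1. \<bar>blinfun_apply u y\<bar>)"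

lemma norm_on_least:
  assumes "subspace Y" "\<And>y. y \<in> Y \<Longrightarrow> norm y \<le> 1 \<Longrightarrow> \<bar>blinfun_apply u y\<bar> \<le> K"
  shows "norm_on Y u \<le> K"
  unfolding norm_on_def
proof (rule cSUP_least)
  show "Y \<inter> cball 0 1 \<noteq> {}" using subspace_0[OF assms(1)] by force
qed (use assms(2) in auto)

lemma norm_on_upper:
  assumes "y \<in> Y" "norm y \<le> 1"
  shows "\<bar>blinfun_apply u y\<bar> \<le> norm_on Y u"
  unfolding norm_on_def
proof (rule cSUP_upper)
  show "bdd_above ((\<lambda>y. \<bar>blinfun_apply u y\<bar>) ` (Y \<inter> cball 0 1))"
  proof (rule bdd_aboveI2)
    fix y assume "y \<in> Y \<inter> cball 0 1"
    then show "\<bar>blinfun_apply u y\<bar> \<le> norm u"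
      using norm_blinfun[of u y] mult_left_le[of "norm y" "norm u"] by simp
  qed
qed (use assms in auto)

lemma norm_on_bound:
  assumes "subspace Y" "y \<in> Y"
  shows "\<bar>blinfun_apply u y\<bar> \<le> norm_on Y u * norm y"
proof (cases "y = 0")
  case False
  have "\<bar>blinfun_apply u (inverse (norm y) *\<^sub>R y)\<bar> \<le> norm_on Y u"
    using False assms by (intro norm_on_upper subspace_scale) auto
  then show ?thesis using False by (simp add: blinfun.scaleR_right abs_mult field_simps)
qed simp

lemma norm_on_nonneg: "subspace Y \<Longrightarrow> 0 \<le> norm_on Y u"
  using norm_on_upper[of 0 Y u] subspace_0 by auto

lemma norm_on_le_norm: assumes "subspace Y" shows "norm_on Y u \<le> norm u"
proof (rule norm_on_least[OF assms])
  fix y assume "y \<in> Y" "norm y \<le> 1"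
  then show "\<bar>blinfun_apply u y\<bar> \<le> norm u"
    using norm_blinfun[of u y] mult_left_le[of "norm y" "norm u"] by simp
qed

lemma norm_on_triangle:
  assumes "subspace Y"
  shows "norm_on Y (u + w) \<le> norm_on Y u + norm_on Y w"
proof (rule norm_on_least[OF assms])
  fix y assume "y \<in> Y" "norm y \<le> 1"
  from norm_on_upper[OF this, of u] norm_on_upper[OF this, of w]
  show "\<bar>blinfun_apply (u + w) y\<bar> \<le> norm_on Y u + norm_on Y w" by (simp add: blinfun.add_left)
qed

lemma norm_on_scale_le:
  assumes "subspace Y" "0 \<le> t"
  shows "norm_on Y (t *\<^sub>R u) \<le> t * norm_on Y u"
proof (rule norm_on_least[OF assms(1)])
  fix y assume "y \<in> Y" "norm y \<le> 1"
  from norm_on_upper[OF this, of u]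
  show "\<bar>blinfun_apply (t *\<^sub>R u) y\<bar> \<le> t * norm_on Y u"
    using assms(2) by (simp add: blinfun.scaleR_left abs_mult mult_left_mono)
qed

lemma norming_functional:
  fixes z :: "'a::real_normed_vector"
  assumes "0 \<le> c"
  obtains u :: "'a \<Rightarrow>\<^sub>L real" where "norm u \<le> c" "u z = c * norm z"
proof -
  have "0 \<le> sum_list (map snd l) + c * norm (sum_list (map fst l))" if l: "set l \<subseteq> {(- z, - (c * norm z))}" for l
  proof -
    have "sum_list (map snd l) = - (real (length l) * (c * norm z)) \<and> sum_list (map fst l) = - (real (length l) *\<^sub>R z)"
      using l by (induction l) (auto simp: algebra_simps)
    then show ?thesis by simp
  qed
  then obtain u :: "'a \<Rightarrow>\<^sub>L real" where u: "norm u \<le> c" "u (- z) \<le> - (c * norm z)"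
    using mazur_orlicz[OF assms, of "{(- z, - (c * norm z))}"] by (metis singletonI)
  then have "u z = c * norm z" using blinfun_le_norm[OF u(1), of z] by (simp add: blinfun.minus_right)
  then show thesis using that u by blast
qed

text \<open>The two dense sequences do different work. The \<open>d n\<close> detect nearness in
  \<open>norm_on Y\<close>, which makes maximisers stable; the \<open>e n\<close> detect pointwise
  convergence on \<open>Y\<close>, which makes maximisers exist without an appeal to weak-star
  compactness.\<close>

locale separable_dual =
  fixes Y :: "'a::real_normed_vector set" and d :: "nat \<Rightarrow> ('a \<Rightarrow>\<^sub>L real)" and e :: "nat \<Rightarrow> 'a"
    and c \<kappa> :: real
  assumes Y: "subspace Y" and eY: "\<And>n. e n \<in> Y" and e_dense: "Y \<subseteq> closure (range e)"
    and c: "0 < c" and d_le: "\<And>n. norm (d n) \<le> c"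
    and d_dense: "\<And>u r. norm u \<le> c \<Longrightarrow> 0 < r \<Longrightarrow> \<exists>n. \<forall>y\<in>Y. \<bar>blinfun_apply u y - blinfun_apply (d n) y\<bar> \<le> r * norm y"
    and \<kappa>: "0 < \<kappa>"
begin

text \<open>Scaling into the unit ball bounds all evaluations on the dual ball uniformly, as the
  weighted series requires; the summand 1 covers \<open>e n = 0\<close>.\<close>

definition "b n = inverse (1 + norm (e n)) *\<^sub>R e n"

definition "P n u = (norm_on Y (u - d n))\<^sup>2 + (blinfun_apply u (b n))\<^sup>2"

definition "\<Phi> u = \<kappa> * (\<Sum>n. (1/2)^n * P n u)"

text \<open>The conjugate of \<open>\<Phi>\<close> restricted to the dual ball of radius
  \<open>c\<close>; with \<open>\<Phi> = 0\<close> it would be \<open>c * norm z\<close>. Its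
  smoothness along \<open>Y\<close> reflects that near maximisers cluster at one functional.\<close>

definition "V z = (SUP u\<in>cball 0 c. blinfun_apply u z - \<Phi> u)"

lemma norm_b: "norm (b n) \<le> 1"
  by (simp add: b_def field_simps add_pos_nonneg)

lemma P_nonneg: "0 \<le> P n u"
  by (simp add: P_def)

lemma P_le: assumes "norm u \<le> c" shows "P n u \<le> 5 * c\<^sup>2"
proof -
  have "norm_on Y (u - d n) \<le> 2 * c"
    using norm_on_le_norm[OF Y, of "u - d n"] norm_triangle_ineq4[of u "d n"] assms d_le[of n] by linarith
  then have "(norm_on Y (u - d n))\<^sup>2 \<le> (2 * c)\<^sup>2"
    by (rule power_mono) (rule norm_on_nonneg[OF Y])
  moreover have "\<bar>blinfun_apply u (b n)\<bar> \<le> \<bar>c\<bar>"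
    using blinfun_le_norm[OF assms, of "b n"] mult_left_le[OF norm_b[of n], of c] c by linarith
  then have "(blinfun_apply u (b n))\<^sup>2 \<le> c\<^sup>2" by (simp add: abs_le_square_iff)
  ultimately show ?thesis by (simp add: P_def power_mult_distrib)
qed

lemma P_summable: assumes "norm u \<le> c" shows "summable (\<lambda>n. (1/2)^n * P n u)"
proof (rule summable_comparison_test')
  show "summable (\<lambda>n. (1/2::real)^n * (5 * c\<^sup>2))"
    by (intro summable_mult2 summable_geometric) simp
  show "norm ((1/2)^n * P n u) \<le> (1/2)^n * (5 * c\<^sup>2)" for n
    using P_le[OF assms, of n] P_nonneg[of n u] by (simp add: abs_mult mult_left_mono)
qed

lemma \<Phi>_nonneg: "norm u \<le> c \<Longrightarrow> 0 \<le> \<Phi> u"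
  unfolding \<Phi>_def using \<kappa> P_summable P_nonneg by (intro mult_nonneg_nonneg suminf_nonneg) auto

text \<open>The constant 10 is 5 from each summand, namely 4 from a distance of at most
  \<open>2 * c\<close> and 1 from an evaluation, times the sum 2 of the weights.\<close>

lemma \<Phi>_le: assumes "norm u \<le> c" shows "\<Phi> u \<le> \<kappa> * (10 * c\<^sup>2)"
proof -
  have g: "summable (\<lambda>n. (1/2::real)^n)" by (intro summable_geometric) simp
  have "(\<Sum>n. (1/2)^n * P n u) \<le> (\<Sum>n. (1/2)^n * (5 * c\<^sup>2))"
    using P_le[OF assms] by (intro suminf_le P_summable assms summable_mult2 g) (auto intro: mult_left_mono)
  also have "\<dots> = (\<Sum>n. (1/2)^n) * (5 * c\<^sup>2)"
    using suminf_mult2[OF g, of "5 * c\<^sup>2"] by simp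
  also have "\<dots> = 10 * c\<^sup>2" by (subst suminf_geometric) auto
  finally show ?thesis unfolding \<Phi>_def using \<kappa> by (intro mult_left_mono) auto
qed

lemma V_bdd: "bdd_above ((\<lambda>u. blinfun_apply u z - \<Phi> u) ` cball 0 c)"
proof (rule bdd_aboveI2)
  fix u :: "'a \<Rightarrow>\<^sub>L real" assume "u \<in> cball 0 c"
  then show "blinfun_apply u z - \<Phi> u \<le> c * norm z"
    using blinfun_le_norm[of u c z] \<Phi>_nonneg[of u] by simp
qed

lemma V_upper: "norm u \<le> c \<Longrightarrow> blinfun_apply u z - \<Phi> u \<le> V z"
  unfolding V_def by (rule cSUP_upper[OF _ V_bdd]) simp

lemma V_least: "(\<And>u. norm u \<le> c \<Longrightarrow> blinfun_apply u z - \<Phi> u \<le> K) \<Longrightarrow> V z \<le> K"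
  unfolding V_def using c by (intro cSUP_least) auto

lemma V_approx:
  assumes "0 < t" obtains u where "norm u \<le> c" "V z - t < blinfun_apply u z - \<Phi> u"
proof -
  have "\<exists>u\<in>cball 0 c. V z - t < blinfun_apply u z - \<Phi> u"
    using less_cSUP_iff[OF _ V_bdd, of "V z - t" z] assms c unfolding V_def by auto
  then show thesis using that by auto
qed

lemma V_lipschitz: "V (z + h) \<le> V z + c * norm h"
proof (rule V_least)
  fix u :: "'a \<Rightarrow>\<^sub>L real" assume u: "norm u \<le> c"
  from V_upper[OF u, of z] blinfun_le_norm[OF u, of h]
  show "blinfun_apply u (z + h) - \<Phi> u \<le> V z + c * norm h" by (simp add: blinfun.add_right)
qed

lemma V_le: "V z \<le> c * norm z"
proof (rule V_least)
  fix u :: "'a \<Rightarrow>\<^sub>L real" assume u: "norm u \<le> c"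
  from \<Phi>_nonneg[OF u] blinfun_le_norm[OF u, of z]
  show "blinfun_apply u z - \<Phi> u \<le> c * norm z" by simp
qed

lemma V_ge: "c * norm z - \<kappa> * (10 * c\<^sup>2) \<le> V z"
proof -
  obtain u :: "'a \<Rightarrow>\<^sub>L real" where u: "norm u \<le> c" "u z = c * norm z"
    using norming_functional[of c z] c by auto
  show ?thesis using V_upper[OF u(1), of z] \<Phi>_le[OF u(1)] u(2) by linarith
qed

text \<open>Uniform convexity of squares, via the parallelogram identity at the midpoint
  \<open>m\<close>. The objective at \<open>m\<close> is at most \<open>V z\<close>, so the
  convexity gap of \<open>\<Phi>\<close> is at most \<open>t\<close>. All terms of that gap are
  nonnegative, which lets a single index be isolated; the factor 4 is the denominator in
  \<open>G\<close>.\<close>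

lemma near_maximizers:
  assumes u: "norm u \<le> c" "V z - t \<le> blinfun_apply u z - \<Phi> u"
    and w: "norm w \<le> c" "V z - t \<le> blinfun_apply w z - \<Phi> w"
  shows "\<kappa> * (1/2)^n * ((norm_on Y (u - d n) - norm_on Y (w - d n))\<^sup>2 + (blinfun_apply u (b n) - blinfun_apply w (b n))\<^sup>2) \<le> 4 * t"
proof -
  define m where "m = (1/2) *\<^sub>R (u + w)"
  have m: "norm m \<le> c" using u(1) w(1) norm_triangle_ineq[of u w] by (simp add: m_def)
  define G where "G n = ((norm_on Y (u - d n) - norm_on Y (w - d n))\<^sup>2 + (blinfun_apply u (b n) - blinfun_apply w (b n))\<^sup>2) / 4" for n
  have G: "G n \<le> P n u / 2 + P n w / 2 - P n m" for n
  proof -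
    have eq: "m - d n = (1/2) *\<^sub>R ((u - d n) + (w - d n))"
      by (simp add: m_def algebra_simps flip: scaleR_add_left)
    have "norm_on Y (m - d n) \<le> (norm_on Y (u - d n) + norm_on Y (w - d n)) / 2"
      unfolding eq using norm_on_scale_le[OF Y, of "1/2" "(u - d n) + (w - d n)"] norm_on_triangle[OF Y, of "u - d n" "w - d n"]
      by simp
    then have "(norm_on Y (m - d n))\<^sup>2 \<le> ((norm_on Y (u - d n) + norm_on Y (w - d n)) / 2)\<^sup>2"
      by (rule power_mono) (rule norm_on_nonneg[OF Y])
    moreover have "blinfun_apply m (b n) = (blinfun_apply u (b n) + blinfun_apply w (b n)) / 2"
      by (simp add: m_def blinfun.add_left blinfun.scaleR_left)
    then have "(blinfun_apply m (b n))\<^sup>2 = ((blinfun_apply u (b n) + blinfun_apply w (b n)) / 2)\<^sup>2"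
      by (rule arg_cong)
    moreover have "((p + r) / 2)\<^sup>2 = p\<^sup>2 / 2 + r\<^sup>2 / 2 - (p - r)\<^sup>2 / 4" for p r :: real
      by (simp add: power2_eq_square field_simps)
    ultimately show ?thesis unfolding G_def P_def by (smt (verit) add_divide_distrib)
  qed
  have Gnn: "0 \<le> G n" for n by (simp add: G_def)
  have sm: "summable (\<lambda>n. (1/2)^n * (P n u / 2 + P n w / 2 - P n m))"
    using summable_diff[OF summable_add[OF summable_mult[OF P_summable[OF u(1)], of "1/2"]
      summable_mult[OF P_summable[OF w(1)], of "1/2"]] P_summable[OF m]]
    by (simp add: algebra_simps)
  have "(1/2)^n * G n \<le> (1/2)^n * (P n u / 2 + P n w / 2 - P n m)"
    using G by (intro mult_left_mono) auto
  also have "\<dots> \<le> (\<Sum>n. (1/2)^n * (P n u / 2 + P n w / 2 - P n m))"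
  proof -
    have "0 \<le> (1/2)^k * (P k u / 2 + P k w / 2 - P k m)" for k
      using order.trans[OF Gnn G] by simp
    then show ?thesis using sum_le_suminf[OF sm, of "{n}"] by simp
  qed
  also have "\<dots> = (\<Sum>n. (1/2)^n * P n u) / 2 + (\<Sum>n. (1/2)^n * P n w) / 2 - (\<Sum>n. (1/2)^n * P n m)"
  proof (rule sums_unique[symmetric])
    show "(\<lambda>n. (1/2)^n * (P n u / 2 + P n w / 2 - P n m)) sums
      ((\<Sum>n. (1/2)^n * P n u) / 2 + (\<Sum>n. (1/2)^n * P n w) / 2 - (\<Sum>n. (1/2)^n * P n m))"
      using sums_diff[OF sums_add[OF sums_divide[OF summable_sums[OF P_summable[OF u(1)]], of 2]
        sums_divide[OF summable_sums[OF P_summable[OF w(1)]], of 2]] summable_sums[OF P_summable[OF m]]]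
      by (simp add: algebra_simps)
  qed
  finally have "\<kappa> * ((1/2)^n * G n) \<le> \<kappa> * \<dots>" using \<kappa> by (intro mult_left_mono) auto
  also have "\<dots> = \<Phi> u / 2 + \<Phi> w / 2 - \<Phi> m" by (simp add: \<Phi>_def algebra_simps)
  also have "\<dots> \<le> t"
  proof -
    have "blinfun_apply m z = (blinfun_apply u z + blinfun_apply w z) / 2"
      by (simp add: m_def blinfun.add_left blinfun.scaleR_left)
    then show ?thesis using V_upper[OF m, of z] u(2) w(2) by argo
  qed
  finally show ?thesis by (simp add: G_def)
qed

lemma maximizing_sequence_Cauchy:
  assumes x: "\<And>k. norm (x k) \<le> c" "\<And>k. V z - inverse (real (Suc k)) < blinfun_apply (x k) z - \<Phi> (x k)"
  shows "Cauchy (\<lambda>k. norm_on Y (x k - d n))" "Cauchy (\<lambda>k. blinfun_apply (x k) (b n))"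
proof -
  let ?a = "\<lambda>k. norm_on Y (x k - d n)" and ?b = "\<lambda>k. blinfun_apply (x k) (b n)"
  have "\<exists>M. \<forall>k\<ge>M. \<forall>l\<ge>M. \<bar>?a k - ?a l\<bar> < r \<and> \<bar>?b k - ?b l\<bar> < r" if r: "0 < r" for r
  proof -
    define C where "C = \<kappa> * (1/2)^n"
    have C: "0 < C" using \<kappa> by (simp add: C_def)
    obtain M where M: "inverse (real (Suc M)) < C * r\<^sup>2 / 4"
      using reals_Archimedean[of "C * r\<^sup>2 / 4"] C r by auto
    have "\<bar>?a k - ?a l\<bar> < r \<and> \<bar>?b k - ?b l\<bar> < r" if kl: "M \<le> k" "M \<le> l" for k l
    proof -
      have near: "V z - inverse (real (Suc M)) \<le> blinfun_apply (x j) z - \<Phi> (x j)" if "M \<le> j" for j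
      proof -
        have "inverse (real (Suc j)) \<le> inverse (real (Suc M))" using that by simp
        then show ?thesis using x(2)[of j] by linarith
      qed
      have "C * ((?a k - ?a l)\<^sup>2 + (?b k - ?b l)\<^sup>2) \<le> 4 * inverse (real (Suc M))"
        unfolding C_def by (rule near_maximizers[OF x(1) near[OF kl(1)] x(1) near[OF kl(2)]])
      also have "\<dots> < C * r\<^sup>2" using M by simp
      finally have *: "(?a k - ?a l)\<^sup>2 + (?b k - ?b l)\<^sup>2 < r\<^sup>2" using C by simp
      have "(?a k - ?a l)\<^sup>2 < r\<^sup>2" "(?b k - ?b l)\<^sup>2 < r\<^sup>2"
        using * zero_le_power2[of "?a k - ?a l"] zero_le_power2[of "?b k - ?b l"] by linarith+
      then show ?thesis using r power2_less_imp_less[of "\<bar>?a k - ?a l\<bar>" r] power2_less_imp_less[of "\<bar>?b k - ?b l\<bar>" r] by simp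
    qed
    then show ?thesis by blast
  qed
  then show "Cauchy ?a" "Cauchy ?b"
    unfolding Cauchy_def dist_real_def by meson+
qed

lemma pointwise_Cauchy_on:
  fixes x :: "nat \<Rightarrow> 'a \<Rightarrow>\<^sub>L real"
  assumes x: "\<And>k. norm (x k) \<le> c" and b: "\<And>n. Cauchy (\<lambda>k. blinfun_apply (x k) (b n))" and y: "y \<in> Y"
  shows "Cauchy (\<lambda>k. blinfun_apply (x k) y)"
proof (rule metric_CauchyI)
  fix r :: real assume r: "0 < r"
  obtain n where n: "dist (e n) y < r / (4 * c)"
    using closure_approachable[THEN iffD1, rule_format, OF subsetD[OF e_dense y], of "r / (4 * c)"] r c by auto
  have en: "e n = (1 + norm (e n)) *\<^sub>R b n"
  proof -
    have "1 + norm (e n) \<noteq> 0" using norm_ge_zero[of "e n"] by linarith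
    then show ?thesis by (simp add: b_def)
  qed
  define q where "q = 1 + norm (e n)"
  have q: "0 < q" by (simp add: q_def add_pos_nonneg)
  obtain M where M: "\<And>k l. M \<le> k \<Longrightarrow> M \<le> l \<Longrightarrow> dist (blinfun_apply (x k) (b n)) (blinfun_apply (x l) (b n)) < r / (2 * q)"
    using metric_CauchyD[OF b[of n], of "r / (2 * q)"] r q by auto
  have "dist (blinfun_apply (x k) y) (blinfun_apply (x l) y) < r" if kl: "M \<le> k" "M \<le> l" for k l
  proof -
    have near: "\<bar>blinfun_apply (x j) y - q * blinfun_apply (x j) (b n)\<bar> \<le> r / 4" for j
    proof -
      have "blinfun_apply (x j) y - q * blinfun_apply (x j) (b n) = blinfun_apply (x j) (y - e n)"
        by (subst en) (simp add: blinfun.diff_right blinfun.scaleR_right q_def)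
      also have "\<bar>\<dots>\<bar> \<le> c * norm (y - e n)" by (rule blinfun_le_norm[OF x])
      also have "\<dots> \<le> c * (r / (4 * c))"
        using n c by (intro mult_left_mono) (auto simp: dist_norm norm_minus_commute)
      finally show ?thesis using c by simp
    qed
    have "q * \<bar>blinfun_apply (x k) (b n) - blinfun_apply (x l) (b n)\<bar> < q * (r / (2 * q))"
      using M[OF kl] q by (intro mult_strict_left_mono) (auto simp: dist_real_def)
    then have "\<bar>q * blinfun_apply (x k) (b n) - q * blinfun_apply (x l) (b n)\<bar> < r / 2"
      using q by (simp add: abs_mult flip: right_diff_distrib)
    with near[of k] near[of l] show ?thesis unfolding dist_real_def by linarith
  qed
  then show "\<exists>M. \<forall>m\<ge>M. \<forall>n\<ge>M. dist (blinfun_apply (x m) y) (blinfun_apply (x n) y) < r" by blast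
qed

text \<open>The direct method: a maximising sequence converges pointwise on \<open>Y\<close>, its
  limit extends to the whole space with the same bound, and \<open>\<Phi>\<close> is lower
  semicontinuous along the sequence.\<close>

lemma maximizer_exists:
  assumes z: "z \<in> Y"
  obtains \<xi> where "norm \<xi> \<le> c" "V z \<le> blinfun_apply \<xi> z - \<Phi> \<xi>"
proof -
  have "\<exists>u. norm u \<le> c \<and> V z - inverse (real (Suc k)) < blinfun_apply u z - \<Phi> u" for k
    using V_approx[of "inverse (real (Suc k))" z] by auto
  then obtain x where x: "\<And>k. norm (x k) \<le> c"
    "\<And>k. V z - inverse (real (Suc k)) < blinfun_apply (x k) z - \<Phi> (x k)" by metis
  note C = maximizing_sequence_Cauchy[OF x]
  define g where "g y = lim (\<lambda>k. blinfun_apply (x k) y)" for y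
  have g: "(\<lambda>k. blinfun_apply (x k) y) \<longlonglongrightarrow> g y" if "y \<in> Y" for y
    unfolding g_def using Cauchy_convergent[OF pointwise_Cauchy_on[OF x(1) C(2) that]]
    by (simp add: convergent_LIMSEQ_iff)
  have gadd: "g (y + y') = g y + g y'" if "y \<in> Y" "y' \<in> Y" for y y'
    using LIMSEQ_unique[OF g[OF subspace_add[OF Y that]]] tendsto_add[OF g[OF that(1)] g[OF that(2)]]
    by (simp add: blinfun.add_right)
  have gsc: "g (t *\<^sub>R y) = t * g y" if "y \<in> Y" for t y
    using LIMSEQ_unique[OF g[OF subspace_scale[OF Y that]]] tendsto_mult_left[OF g[OF that], of t]
    by (simp add: blinfun.scaleR_right)
  have gle: "g y \<le> c * norm y" if "y \<in> Y" for y
    using blinfun_le_norm[OF x(1), of _ y] by (intro LIMSEQ_le_const2[OF g[OF that]]) (auto simp: abs_le_iff)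
  obtain L where L: "linear L" "\<And>y. L y \<le> c * norm y" "\<And>y. y \<in> Y \<Longrightarrow> L y = g y"
    using hahn_banach_dominated[OF sublinear_norm[OF less_imp_le[OF c]] Y, of g] gadd gsc gle by blast
  obtain \<xi> :: "'a \<Rightarrow>\<^sub>L real" where \<xi>: "norm \<xi> \<le> c" "\<And>y. \<xi> y = L y"
    using linear_le_norm_blinfun[OF L(1,2)] c by auto
  have lim: "(\<lambda>k. blinfun_apply (x k) y) \<longlonglongrightarrow> \<xi> y" if "y \<in> Y" for y
    using g[OF that] L(3)[OF that] \<xi>(2) by simp
  have bY: "b n \<in> Y" for n unfolding b_def by (intro subspace_scale Y eY)
  \<comment> \<open>Finite sums pass to the limit term by term, so the bound is proved for partial
    sums. The norm terms converge merely to some \<open>a n\<close>, which dominates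
    \<open>norm_on Y (\<xi> - d n)\<close>; that direction suffices.\<close>
  have part: "\<kappa> * (\<Sum>n<N. (1/2)^n * P n \<xi>) \<le> \<xi> z - V z" for N
  proof -
    define a where "a n = lim (\<lambda>k. norm_on Y (x k - d n))" for n
    have a: "(\<lambda>k. norm_on Y (x k - d n)) \<longlonglongrightarrow> a n" for n
      unfolding a_def using Cauchy_convergent[OF C(1)] by (simp add: convergent_LIMSEQ_iff)
    have le_a: "norm_on Y (\<xi> - d n) \<le> a n" for n
    proof (rule norm_on_least[OF Y])
      fix y assume y: "y \<in> Y" "norm y \<le> 1"
      have "(\<lambda>k. \<bar>blinfun_apply (x k) y - d n y\<bar>) \<longlonglongrightarrow> \<bar>\<xi> y - d n y\<bar>"
        by (intro tendsto_intros lim y)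
      moreover have "\<bar>blinfun_apply (x k) y - d n y\<bar> \<le> norm_on Y (x k - d n)" for k
        using norm_on_upper[OF y, of "x k - d n"] by (simp add: blinfun.diff_left)
      ultimately show "\<bar>blinfun_apply (\<xi> - d n) y\<bar> \<le> a n"
        using LIMSEQ_le[OF _ a] by (auto simp: blinfun.diff_left)
    qed
    have "\<kappa> * (\<Sum>n<N. (1/2)^n * P n \<xi>) \<le> \<kappa> * (\<Sum>n<N. (1/2)^n * ((a n)\<^sup>2 + (\<xi> (b n))\<^sup>2))"
      unfolding P_def using \<kappa> le_a norm_on_nonneg[OF Y]
      by (intro mult_left_mono sum_mono add_right_mono power_mono) auto
    also have "\<dots> \<le> \<xi> z - V z + 0"
    proof (rule LIMSEQ_le)
      show "(\<lambda>k. \<kappa> * (\<Sum>n<N. (1/2)^n * P n (x k))) \<longlonglongrightarrow> \<kappa> * (\<Sum>n<N. (1/2)^n * ((a n)\<^sup>2 + (\<xi> (b n))\<^sup>2))"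
        unfolding P_def by (intro tendsto_intros a lim bY)
      show "(\<lambda>k. blinfun_apply (x k) z - V z + inverse (real (Suc k))) \<longlonglongrightarrow> \<xi> z - V z + 0"
        by (intro tendsto_intros lim z LIMSEQ_inverse_real_of_nat)
      have "\<kappa> * (\<Sum>n<N. (1/2)^n * P n (x k)) \<le> blinfun_apply (x k) z - V z + inverse (real (Suc k))" for k
      proof -
        have "(\<Sum>n<N. (1/2)^n * P n (x k)) \<le> (\<Sum>n. (1/2)^n * P n (x k))"
          using P_nonneg by (intro sum_le_suminf P_summable x) auto
        then have "\<kappa> * (\<Sum>n<N. (1/2)^n * P n (x k)) \<le> \<Phi> (x k)"
          unfolding \<Phi>_def using \<kappa> by (intro mult_left_mono) auto
        then show ?thesis using x(2)[of k] by linarith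
      qed
      then show "\<exists>M. \<forall>k\<ge>M. \<kappa> * (\<Sum>n<N. (1/2)^n * P n (x k)) \<le> blinfun_apply (x k) z - V z + inverse (real (Suc k))"
        by blast
    qed
    finally show ?thesis by simp
  qed
  have "\<Phi> \<xi> \<le> \<xi> z - V z"
  proof -
    have "(\<Sum>n. (1/2)^n * P n \<xi>) \<le> (\<xi> z - V z) / \<kappa>"
      using part \<kappa> by (intro suminf_le_const P_summable \<xi>) (simp add: field_simps)
    then show ?thesis using \<kappa> by (simp add: \<Phi>_def field_simps)
  qed
  then show thesis using that[OF \<xi>(1)] by simp
qed

text \<open>An almost maximiser \<open>u\<close> at \<open>z + h\<close> is one at \<open>z\<close>
  too, hence close on \<open>Y\<close> to the maximiser \<open>\<xi>\<close>; replacing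
  \<open>u h\<close> by \<open>\<xi> h\<close> therefore costs little. The distance from
  \<open>u\<close> to \<open>\<xi>\<close> is measured through some \<open>d n\<close> close to
  \<open>\<xi>\<close>.\<close>

lemma V_differentiable_on:
  assumes z: "z \<in> Y"
  obtains \<xi> where "norm \<xi> \<le> c"
    "\<And>r. 0 < r \<Longrightarrow> \<exists>s>0. \<forall>h\<in>Y. norm h < s \<longrightarrow> V (z + h) \<le> V z + blinfun_apply \<xi> h + r * norm h"
proof -
  obtain \<xi> where \<xi>: "norm \<xi> \<le> c" "V z \<le> blinfun_apply \<xi> z - \<Phi> \<xi>"
    using maximizer_exists[OF z] by blast
  have "\<exists>s>0. \<forall>h\<in>Y. norm h < s \<longrightarrow> V (z + h) \<le> V z + blinfun_apply \<xi> h + r * norm h" if r: "0 < r" for r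
  proof -
    define q where "q = r / 6"
    have q: "0 < q" using r by (simp add: q_def)
    obtain n where n: "\<forall>y\<in>Y. \<bar>blinfun_apply \<xi> y - blinfun_apply (d n) y\<bar> \<le> q * norm y"
      using d_dense[OF \<xi>(1) q] by blast
    have nq: "norm_on Y (\<xi> - d n) \<le> q"
    proof (rule norm_on_least[OF Y])
      fix y assume y: "y \<in> Y" "norm y \<le> 1"
      have "q * norm y \<le> q" using q y(2) by (simp add: mult_left_le)
      then show "\<bar>blinfun_apply (\<xi> - d n) y\<bar> \<le> q" using n y(1) by (auto simp: blinfun.diff_left intro: order.trans)
    qed
    define C where "C = \<kappa> * (1/2)^n"
    have C: "0 < C" using \<kappa> by (simp add: C_def)
    define t where "t = C * q\<^sup>2 / 4"
    have t: "0 < t" using C q by (simp add: t_def)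
    have close: "norm_on Y (u - \<xi>) \<le> 3 * q" if u: "norm u \<le> c" "V z - t \<le> blinfun_apply u z - \<Phi> u" for u
    proof -
      have "C * ((norm_on Y (u - d n) - norm_on Y (\<xi> - d n))\<^sup>2 + (blinfun_apply u (b n) - blinfun_apply \<xi> (b n))\<^sup>2) \<le> 4 * t"
        unfolding C_def using \<xi> t by (intro near_maximizers[OF u]) auto
      also have "\<dots> = C * q\<^sup>2" by (simp add: t_def)
      finally have "(norm_on Y (u - d n) - norm_on Y (\<xi> - d n))\<^sup>2 + (blinfun_apply u (b n) - blinfun_apply \<xi> (b n))\<^sup>2 \<le> q\<^sup>2"
        using C by simp
      then have "(norm_on Y (u - d n) - norm_on Y (\<xi> - d n))\<^sup>2 \<le> q\<^sup>2"
        using zero_le_power2[of "blinfun_apply u (b n) - blinfun_apply \<xi> (b n)"] by linarith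
      then have "norm_on Y (u - d n) - norm_on Y (\<xi> - d n) \<le> q"
        by (rule power2_le_imp_le) (use q in simp)
      moreover have "norm_on Y (u - \<xi>) \<le> norm_on Y (u - d n) + norm_on Y (d n - \<xi>)"
        using norm_on_triangle[OF Y, of "u - d n" "d n - \<xi>"] by simp
      moreover have "norm_on Y (d n - \<xi>) = norm_on Y (\<xi> - d n)"
        by (simp add: norm_on_def blinfun.diff_left abs_minus_commute)
      ultimately show ?thesis using nq by linarith
    qed
    \<comment> \<open>The first entry lets an almost maximiser at \<open>z + h\<close> lose
      \<open>c * norm h\<close> twice and one further \<open>norm h\<close> within \<open>t\<close>;
      the second gives \<open>(norm h)\<^sup>2 \<le> norm h\<close>, the third
      \<open>(norm h)\<^sup>2 \<le> r / 2 * norm h\<close>.\<close>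
    define s where "s = min (t / (2 * c + 1)) (min 1 (r / 2))"
    have s: "0 < s" using t c r by (simp add: s_def)
    have "V (z + h) \<le> V z + blinfun_apply \<xi> h + r * norm h" if h: "h \<in> Y" "norm h < s" for h
    proof (cases "h = 0")
      case False
      then obtain u where u: "norm u \<le> c" "V (z + h) - (norm h)\<^sup>2 < blinfun_apply u (z + h) - \<Phi> u"
        using V_approx[of "(norm h)\<^sup>2" "z + h"] by auto
      have sq: "(norm h)\<^sup>2 \<le> norm h" using h s_def by (simp add: power2_eq_square mult_left_le)
      have uh: "\<bar>blinfun_apply u h\<bar> \<le> c * norm h" by (rule blinfun_le_norm[OF u(1)])
      have "V z \<le> V (z + h) + c * norm h" using V_lipschitz[of "z + h" "- h"] by simp
      moreover have "(2 * c + 1) * norm h \<le> t"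
        using h c by (simp add: s_def field_simps)
      ultimately have "V z - t \<le> blinfun_apply u z - \<Phi> u"
        using u(2) uh sq by (simp add: blinfun.add_right algebra_simps)
      from mult_right_mono[OF close[OF u(1) this] norm_ge_zero[of h]]
      have "blinfun_apply (u - \<xi>) h \<le> 3 * q * norm h"
        using norm_on_bound[OF Y h(1), of "u - \<xi>"] by linarith
      then have "blinfun_apply u h \<le> blinfun_apply \<xi> h + r / 2 * norm h"
        by (simp add: q_def blinfun.diff_left)
      moreover have "(norm h)\<^sup>2 \<le> r / 2 * norm h"
      proof -
        have "norm h \<le> r / 2" using h(2) by (simp add: s_def)
        from mult_right_mono[OF this norm_ge_zero[of h]] show ?thesis by (simp add: power2_eq_square)
      qed
      moreover have "V (z + h) \<le> blinfun_apply u z - \<Phi> u + blinfun_apply u h + (norm h)\<^sup>2"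
        using u(2) by (simp add: blinfun.add_right)
      ultimately show ?thesis using V_upper[OF u(1), of z] by linarith
    qed simp
    then show ?thesis using s by blast
  qed
  then show thesis using that[OF \<xi>(1)] by blast
qed

end

text \<open>Lipschitz on the whole space, but with only an upper first-order estimate, and only
  along \<open>Y\<close>: at a minimum of \<open>f + V\<close> an upper bound for \<open>V\<close>
  becomes the lower bound for \<open>f\<close> that a subgradient along \<open>Y\<close>
  requires.\<close>

definition smooth_along :: "'a::real_normed_vector set \<Rightarrow> real \<Rightarrow> ('a \<Rightarrow> real) \<Rightarrow> bool" where
  "smooth_along Y c V \<longleftrightarrow> (\<forall>z h. V (z + h) \<le> V z + c * norm h) \<and>
    (\<forall>z\<in>Y. \<exists>\<xi>. norm \<xi> \<le> c \<and>
      (\<forall>r>0. \<exists>s>0. \<forall>h\<in>Y. norm h < s \<longrightarrow> V (z + h) \<le> V z + blinfun_apply \<xi> h + r * norm h))"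

lemma asplund_smooth_approx_norm:
  fixes Y C :: "'a::real_normed_vector set"
  assumes asp: "asplund TYPE('a)" and Y: "subspace Y" "Y \<subseteq> closure C" and C: "countable C" "C \<subseteq> Y"
    and c: "0 < c" and \<sigma>: "0 < \<sigma>"
  obtains V where "smooth_along Y c V" "\<And>z. V z \<le> c * norm z" "\<And>z. c * norm z - \<sigma> \<le> V z"
proof -
  obtain D :: "('a \<Rightarrow>\<^sub>L real) set" where D: "countable D" "\<And>d. d \<in> D \<Longrightarrow> norm d \<le> c"
    "\<And>x' e. norm x' \<le> c \<Longrightarrow> 0 < e \<Longrightarrow> \<exists>d\<in>D. \<forall>y\<in>Y. \<bar>blinfun_apply x' y - blinfun_apply d y\<bar> \<le> e * norm y"
    using asplund_separable_dual[OF asp Y C(1) c] by blast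
  have neD: "D \<noteq> {}" using D(3)[of 0 1] c by auto
  have neC: "C \<noteq> {}" using Y subspace_0 by fastforce
  have rD: "range (from_nat_into D) = D" using neD D(1) by (rule range_from_nat_into)
  have rC: "range (from_nat_into C) = C" using neC C(1) by (rule range_from_nat_into)
  \<comment> \<open>The weight makes \<open>\<kappa> * (10 * c\<^sup>2)\<close>, the bound on the
    deviation from \<open>c * norm z\<close>, equal to \<open>\<sigma>\<close>.\<close>
  interpret separable_dual Y "from_nat_into D" "from_nat_into C" c "\<sigma> / (10 * c\<^sup>2)"
  proof
    show "\<exists>n. \<forall>y\<in>Y. \<bar>blinfun_apply u y - blinfun_apply (from_nat_into D n) y\<bar> \<le> r * norm y"
      if "norm u \<le> c" "0 < r" for u :: "'a \<Rightarrow>\<^sub>L real" and r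
      using D(3)[OF that] from_nat_into_surj[OF D(1)] by metis
    show "from_nat_into C n \<in> Y" for n using from_nat_into[OF neC] C(2) by blast
    show "norm (from_nat_into D n) \<le> c" for n by (rule D(2)[OF from_nat_into[OF neD]])
  qed (use Y c \<sigma> rC in auto)
  show thesis
  proof (rule that)
    show "smooth_along Y c V"
      unfolding smooth_along_def using V_lipschitz V_differentiable_on by metis
    show "V z \<le> c * norm z" for z by (rule V_le)
    show "c * norm z - \<sigma> \<le> V z" for z using V_ge[of z] c by simp
  qed
qed

section \<open>A smooth variational principle\<close>

lemma lsc_eventually:
  assumes "lsc f" "M < f x"
  shows "\<forall>\<^sub>F y in nhds x. M < f y"
proof -
  have "M < Liminf (at x) f" using assms by (auto simp: lsc_def intro: less_le_trans)
  then have "\<forall>\<^sub>F y in at x. M < f y" by (rule less_LiminfD)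
  then show ?thesis using assms(2) by (auto simp: eventually_at_filter elim: eventually_mono)
qed

lemma lsc_tendsto_le:
  fixes f :: "'a::topological_space \<Rightarrow> ereal"
  assumes f: "lsc f" and x: "x \<longlonglongrightarrow> l" and M: "M \<longlonglongrightarrow> m" and le: "\<And>n. f (x n) \<le> ereal (M n)"
  shows "f l \<le> ereal m"
proof (rule ccontr)
  assume "\<not> f l \<le> ereal m"
  then obtain m' where m': "ereal m < ereal m'" "ereal m' < f l"
    using ereal_dense2[of "ereal m" "f l"] by (auto simp: not_le)
  have "\<forall>\<^sub>F n in sequentially. ereal m' < f (x n)"
    using lsc_eventually[OF f m'(2)] x by (rule eventually_compose_filterlim)
  moreover have "\<forall>\<^sub>F n in sequentially. M n < m'"
    using M m'(1) by (intro order_tendstoD(2)) auto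
  ultimately have "\<forall>\<^sub>F n in sequentially. False"
  proof eventually_elim
    case (elim n)
    have "f (x n) < ereal m'" using le[of n] elim(2) by (meson le_less_trans ereal_less_eq(3) less_ereal.simps(1))
    then show False using elim(1) by simp
  qed
  then show False by simp
qed

text \<open>The quotient in the Frechet condition is cleared, so no extended-real division occurs,
  and increments can be confined to \<open>Y\<close> while the functional still acts on the whole
  space.\<close>

definition subgrad_on :: "'a::real_normed_vector set \<Rightarrow> ('a \<Rightarrow> ereal) \<Rightarrow> 'a \<Rightarrow> ('a \<Rightarrow>\<^sub>L real) \<Rightarrow> bool" where
  "subgrad_on Y f x x' \<longleftrightarrow> (\<forall>r>0. \<exists>s>0. \<forall>h\<in>Y. norm h < s \<longrightarrow>
     f x + ereal (blinfun_apply x' h - r * norm h) \<le> f (x + h))"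

lemma approximate_minimum:
  fixes g :: "'a \<Rightarrow> real"
  assumes x: "x \<in> S" and low: "\<And>u. u \<in> S \<Longrightarrow> m \<le> g u" and s: "0 < s"
  obtains x' where "x' \<in> S" "g x' \<le> g x" "\<And>u. u \<in> S \<Longrightarrow> g x' \<le> g u + s"
proof -
  have bdd: "bdd_below (g ` S)" using low by (rule bdd_belowI2)
  have "(INF u\<in>S. g u) < (INF u\<in>S. g u) + s" using s by simp
  then obtain u0 where u0: "u0 \<in> S" "g u0 < (INF u\<in>S. g u) + s"
    using cINF_less_iff[OF _ bdd] x by blast
  have u0_le: "g u0 \<le> g u + s" if "u \<in> S" for u
    using cINF_lower[OF bdd that] u0(2) by linarith
  show thesis
  proof (cases "g x \<le> g u0")
    case True
    then show thesis using that[OF x] u0_le by force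
  next
    case False
    then show thesis using that[OF u0(1)] u0_le by simp
  qed
qed

lemma smooth_along_suminf:
  fixes W :: "nat \<Rightarrow> 'a::real_normed_vector \<Rightarrow> real"
  assumes Y: "subspace Y" and W: "\<And>i. smooth_along Y (a i) (W i)" and y: "\<And>i. y i \<in> Y"
    and a: "summable a" "\<And>i. 0 \<le> a i" and sW: "\<And>z. summable (\<lambda>i. W i (z - y i))"
  shows "smooth_along Y (suminf a) (\<lambda>z. \<Sum>i. W i (z - y i))"
  unfolding smooth_along_def
proof (intro conjI allI ballI)
  fix z h
  have "(\<Sum>i. W i (z + h - y i)) \<le> (\<Sum>i. W i (z - y i) + a i * norm h)"
  proof (rule suminf_le[OF _ sW])
    show "summable (\<lambda>i. W i (z - y i) + a i * norm h)"
      by (intro summable_add sW summable_mult2 a)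
    show "W i (z + h - y i) \<le> W i (z - y i) + a i * norm h" for i
      using W[of i] unfolding smooth_along_def by (metis add_diff_eq add.commute diff_add_eq)
  qed
  also have "\<dots> = (\<Sum>i. W i (z - y i)) + suminf a * norm h"
    using suminf_add[OF sW summable_mult2[OF a(1)], of z "norm h"] suminf_mult2[OF a(1), of "norm h"] by simp
  finally show "(\<Sum>i. W i (z + h - y i)) \<le> (\<Sum>i. W i (z - y i)) + suminf a * norm h" .
next
  fix z assume z: "z \<in> Y"
  have "\<exists>\<xi>. norm \<xi> \<le> a i \<and> (\<forall>r>0. \<exists>s>0. \<forall>h\<in>Y. norm h < s \<longrightarrow>
      W i (z - y i + h) \<le> W i (z - y i) + blinfun_apply \<xi> h + r * norm h)" for i
    using W[of i] subspace_diff[OF Y z y[of i]] unfolding smooth_along_def by blast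
  then obtain \<xi> where \<xi>: "\<And>i. norm (\<xi> i) \<le> a i"
    and smooth: "\<And>i r. 0 < r \<Longrightarrow> \<exists>s>0. \<forall>h\<in>Y. norm h < s \<longrightarrow>
      W i (z - y i + h) \<le> W i (z - y i) + blinfun_apply (\<xi> i) h + r * norm h" by metis
  have sn: "summable (\<lambda>i. norm (\<xi> i))" by (rule summable_comparison_test'[OF a(1)]) (use \<xi> in auto)
  then have s\<xi>: "summable \<xi>" by (rule summable_norm_cancel)
  have app: "blinfun_apply (suminf \<xi>) h = (\<Sum>i. blinfun_apply (\<xi> i) h)" for h
    by (rule bounded_linear.suminf[OF blinfun.bounded_linear_left s\<xi>])
  have sapp: "summable (\<lambda>i. blinfun_apply (\<xi> i) h)" for h
    by (rule bounded_linear.summable[OF blinfun.bounded_linear_left s\<xi>])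
  show "\<exists>\<xi>. norm \<xi> \<le> suminf a \<and> (\<forall>r>0. \<exists>s>0. \<forall>h\<in>Y. norm h < s \<longrightarrow>
      (\<Sum>i. W i (z + h - y i)) \<le> (\<Sum>i. W i (z - y i)) + blinfun_apply \<xi> h + r * norm h)"
  proof (intro exI[of _ "suminf \<xi>"] conjI allI impI)
    show "norm (suminf \<xi>) \<le> suminf a"
      using summable_norm[OF sn] suminf_le[OF \<xi> sn a(1)] by linarith
    fix r :: real assume r: "0 < r"
    have "(\<lambda>n. \<Sum>i. a (i + n)) \<longlonglongrightarrow> 0" by (rule suminf_exist_split2[OF a(1)])
    \<comment> \<open>In the tail each term contributes its Lipschitz constant and the norm of
      \<open>\<xi> i\<close>, hence at most twice \<open>a i\<close>; a tail sum below
      \<open>r / 4\<close> thus costs \<open>r / 2\<close>. The head gets the other half, shared out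
      by \<open>\<rho>\<close>.\<close>
    then obtain N where N: "(\<Sum>i. a (i + N)) < r / 4"
      using r order_tendstoD(2)[of _ 0 sequentially "r / 4"] by (force simp: eventually_sequentially)
    define \<rho> where "\<rho> = r / (2 * (real N + 1))"
    have \<rho>: "0 < \<rho>" using r by (simp add: \<rho>_def)
    obtain s where s: "\<And>i. 0 < s i"
      and sW': "\<And>i h. h \<in> Y \<Longrightarrow> norm h < s i \<Longrightarrow> W i (z - y i + h) \<le> W i (z - y i) + blinfun_apply (\<xi> i) h + \<rho> * norm h"
      using smooth[OF \<rho>] by metis
    define s0 where "s0 = Min (insert 1 (s ` {..<N}))"
    have s0: "0 < s0" "\<And>i. i < N \<Longrightarrow> s0 \<le> s i"
      using s by (auto simp: s0_def)
    have "(\<Sum>i. W i (z + h - y i)) \<le> (\<Sum>i. W i (z - y i)) + blinfun_apply (suminf \<xi>) h + r * norm h"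
      if h: "h \<in> Y" "norm h < s0" for h
    proof -
      define D where "D i = W i (z + h - y i) - W i (z - y i) - blinfun_apply (\<xi> i) h" for i
      have eq: "z - y i + h = z + h - y i" for i by simp
      have sD: "summable D" unfolding D_def by (intro summable_diff sW sapp)
      have "(\<Sum>i<N. D i) \<le> (\<Sum>i<N. \<rho> * norm h)"
        using sW'[OF h(1)] h(2) s0(2) unfolding D_def eq by (intro sum_mono) (force simp: algebra_simps)
      also have "\<dots> \<le> r / 2 * norm h"
      proof -
        have "real N * \<rho> \<le> r / 2" using r by (simp add: \<rho>_def field_simps)
        from mult_right_mono[OF this norm_ge_zero[of h]] show ?thesis by simp
      qed
      finally have init: "(\<Sum>i<N. D i) \<le> r / 2 * norm h" .
      have tail: "D i \<le> 2 * norm h * a i" for i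
      proof -
        have "W i (z - y i + h) \<le> W i (z - y i) + a i * norm h"
          using W[of i] unfolding smooth_along_def by blast
        then show ?thesis using blinfun_le_norm[OF \<xi>[of i], of h] unfolding D_def eq by (simp add: algebra_simps abs_le_iff)
      qed
      have "(\<Sum>i. D (i + N)) \<le> (\<Sum>i. 2 * norm h * a (i + N))"
        by (intro suminf_le tail summable_mult) (simp_all add: sD a(1) summable_iff_shift)
      also have "\<dots> = 2 * norm h * (\<Sum>i. a (i + N))"
        by (intro suminf_mult) (simp add: a(1) summable_iff_shift)
      also have "\<dots> \<le> 2 * norm h * (r / 4)" using N by (intro mult_left_mono) auto
      finally have "suminf D \<le> r * norm h"
        using suminf_split_initial_segment[OF sD, of N] init by (simp add: algebra_simps)
      moreover have "suminf D = (\<Sum>i. W i (z + h - y i)) - (\<Sum>i. W i (z - y i)) - blinfun_apply (suminf \<xi>) h"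
        unfolding D_def app using suminf_diff[OF summable_diff[OF sW sW] sapp] suminf_diff[OF sW sW] by metis
      ultimately show ?thesis by linarith
    qed
    then show "\<exists>s>0. \<forall>h\<in>Y. norm h < s \<longrightarrow>
      (\<Sum>i. W i (z + h - y i)) \<le> (\<Sum>i. W i (z - y i)) + blinfun_apply (suminf \<xi>) h + r * norm h"
      using s0(1) by blast
  qed
qed

text \<open>A construction of Borwein-Preiss type. Each near minimiser becomes the centre of a
  further smooth perturbation, with Lipschitz constants summing to \<open>c + \<eta>\<close>; the
  points converge to an exact minimiser of \<open>f + R\<close> on \<open>Y\<close>, where the
  derivative of \<open>R\<close> yields the subgradient. The first perturbation stands in for the
  non-smooth \<open>c * norm (u - xh)\<close>.\<close>

lemma smooth_variational_principle:
  fixes f :: "'a::banach \<Rightarrow> ereal"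
  assumes Y: "subspace Y" "closed Y" and f: "lsc f" "\<And>x. f x \<noteq> -\<infinity>"
    and xh: "xh \<in> Y" "f xh = ereal fh" and c: "0 \<le> c" and \<eta>: "0 < \<eta>"
    and min: "\<And>u. u \<in> Y \<Longrightarrow> ereal (fh - c * norm (u - xh)) \<le> f u"
    and approx: "\<And>c \<sigma>. 0 < c \<Longrightarrow> 0 < \<sigma> \<Longrightarrow>
      \<exists>V. smooth_along Y c V \<and> (\<forall>z. V z \<le> c * norm z) \<and> (\<forall>z. c * norm z - \<sigma> \<le> V z)"
  obtains x x' where "x \<in> Y" "norm (x - xh) < \<eta>" "f x < ereal (fh + \<eta>)" "norm x' \<le> c + \<eta>" "subgrad_on Y f x x'"
proof -
  define F where "F u = real_of_ereal (f u)" for u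
  define S where "S = {u \<in> Y. f u \<noteq> \<infinity>}"
  have fF: "f u = ereal (F u)" if "u \<in> S" for u
    using that f(2)[of u] by (cases "f u") (auto simp: S_def F_def)
  have xhS: "xh \<in> S" using xh by (auto simp: S_def)
  have Fxh: "F xh = fh" by (simp add: F_def xh(2))
  have Fmin: "fh - c * norm (u - xh) \<le> F u" if "u \<in> S" for u
    using min[of u] fF[OF that] that by (auto simp: S_def)
  \<comment> \<open>The bound \<open>\<eta>\<^sup>2 / 32\<close> keeps the total displacement
    \<open>2 * K\<close> below \<open>\<eta>\<close>, and \<open>\<eta> / 4\<close> keeps the total
    error \<open>\<sigma> * (4/3)\<close> below \<open>\<eta>\<close>.\<close>
  define \<sigma> where "\<sigma> = min (\<eta>\<^sup>2 / 32) (\<eta> / 4)"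
  have \<sigma>: "0 < \<sigma>" using \<eta> by (simp add: \<sigma>_def)
  \<comment> \<open>The errors shrink like \<open>(1/4)^n\<close>, faster than the Lipschitz
    constants with \<open>(1/2)^n\<close>, so the steps between successive points, of order
    \<open>s n / a (Suc n)\<close>, are summable.\<close>
  define s where "s n = \<sigma> * (1/4)^n" for n :: nat
  define a where "a n = (if n = 0 then c + \<eta> / 2 else \<eta> / 2 * (1/2)^n)" for n :: nat
  have s: "0 < s n" for n using \<sigma> by (simp add: s_def)
  have a: "0 < a n" for n using \<eta> c by (simp add: a_def)
  have s_sums: "s sums (\<sigma> * (4/3))"
    unfolding s_def using sums_mult[OF geometric_sums[of "1/4::real"], of \<sigma>] by simp
  have a_sums: "a sums (c + \<eta>)"
  proof -
    have "(\<lambda>n. (\<eta> / 2) * (1/2)^n) sums ((\<eta> / 2) * 2)"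
      using sums_mult[OF geometric_sums[of "1/2::real"], of "\<eta> / 2"] by simp
    moreover have "(\<lambda>n::nat. if n = 0 then c else 0) sums c"
      using sums_single[of 0 "\<lambda>_. c"] by simp
    ultimately have "(\<lambda>n. (\<eta> / 2) * (1/2)^n + (if n = 0 then c else 0)) sums ((\<eta> / 2) * 2 + c)"
      by (rule sums_add)
    moreover have "(\<lambda>n. (\<eta> / 2) * (1/2)^n + (if n = 0 then c else 0)) = a"
      by (auto simp: a_def)
    ultimately show ?thesis by (simp add: add.commute)
  qed
  have "\<exists>V. smooth_along Y (a n) V \<and> (\<forall>z. V z \<le> a n * norm z) \<and> (\<forall>z. a n * norm z - s n \<le> V z)" for n
    by (rule approx[OF a s])
  then obtain W where W: "\<And>n. smooth_along Y (a n) (W n)" "\<And>n z. W n z \<le> a n * norm z"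
    "\<And>n z. a n * norm z - s n \<le> W n z" by metis
  have W0: "W n 0 \<le> 0" for n using W(2)[of n 0] by simp
  have Wlow: "- s n \<le> W n z" for n z
    using W(3)[of n z] mult_nonneg_nonneg[OF less_imp_le[OF a[of n]] norm_ge_zero[of z]] by linarith
  define P where "P n p \<longleftrightarrow> (case p of (x, T) \<Rightarrow> x \<in> S \<and> (\<forall>u\<in>S. F x + T x \<le> F u + T u + s n) \<and>
    (n = 0 \<longrightarrow> x = xh \<and> T = (\<lambda>z. W 0 (z - xh))))" for n :: nat and p :: "'a \<times> ('a \<Rightarrow> real)"
  define Q where "Q n p p' \<longleftrightarrow> (case p of (x, T) \<Rightarrow> case p' of (x', T') \<Rightarrow>
    T' = (\<lambda>z. T z + W (Suc n) (z - x)) \<and> F x' + T' x' \<le> F x + T' x)" for n :: nat and p p' :: "'a \<times> ('a \<Rightarrow> real)"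
  have "\<exists>p. \<forall>n. P n (p n) \<and> Q n (p n) (p (Suc n))"
  proof (rule dependent_nat_choice)
    have "F xh + W 0 (xh - xh) \<le> F u + W 0 (u - xh) + s 0" if "u \<in> S" for u
    proof -
      have "c * norm (u - xh) \<le> a 0 * norm (u - xh)" using \<eta> by (intro mult_right_mono) (auto simp: a_def)
      then show ?thesis using Fmin[OF that] W(3)[of 0 "u - xh"] W0[of 0] Fxh by simp
    qed
    then show "\<exists>p. P 0 p" using xhS by (intro exI[of _ "(xh, \<lambda>z. W 0 (z - xh))"]) (simp add: P_def)
  next
    fix p n assume p: "P n p"
    obtain x T where pT: "p = (x, T)" by (cases p)
    have x: "x \<in> S" "\<And>u. u \<in> S \<Longrightarrow> F x + T x \<le> F u + T u + s n" using p by (auto simp: P_def pT)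
    define T' where "T' = (\<lambda>z. T z + W (Suc n) (z - x))"
    have "F x + T x - s n - s (Suc n) \<le> F u + T' u" if "u \<in> S" for u
      using x(2)[OF that] Wlow[of "Suc n" "u - x"] by (simp add: T'_def)
    then obtain x' where "x' \<in> S" "F x' + T' x' \<le> F x + T' x" "\<And>u. u \<in> S \<Longrightarrow> F x' + T' x' \<le> F u + T' u + s (Suc n)"
      using approximate_minimum[OF x(1), of "F x + T x - s n - s (Suc n)" "\<lambda>u. F u + T' u" "s (Suc n)"] s by blast
    then show "\<exists>p'. P (Suc n) p' \<and> Q n p p'"
      by (intro exI[of _ "(x', T')"]) (auto simp: P_def Q_def pT T'_def)
  qed
  then obtain p where p: "\<And>n. P n (p n)" "\<And>n. Q n (p n) (p (Suc n))" by blast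
  define x where "x n = fst (p n)" for n
  define T where "T n = snd (p n)" for n
  have x0: "x 0 = xh" and T0: "T 0 = (\<lambda>z. W 0 (z - xh))"
    using p(1)[of 0] by (auto simp: P_def x_def T_def split: prod.splits)
  have xS: "x n \<in> S" and xmin: "u \<in> S \<Longrightarrow> F (x n) + T n (x n) \<le> F u + T n u + s n" for n u
    using p(1)[of n] by (auto simp: P_def x_def T_def split: prod.splits)
  have TS: "T (Suc n) = (\<lambda>z. T n z + W (Suc n) (z - x n))"
    and dec: "F (x (Suc n)) + T (Suc n) (x (Suc n)) \<le> F (x n) + T (Suc n) (x n)" for n
    using p(2)[of n] by (auto simp: Q_def x_def T_def split: prod.splits)
  \<comment> \<open>Descent and near minimality bound \<open>a (Suc n)\<close> times the step length
    by \<open>2 * s n\<close>; since \<open>a (Suc n) = \<eta> / 4 * (1/2)^n\<close>, the quotient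
    is \<open>K * (1/2)^n\<close>.\<close>
  define K where "K = 8 * \<sigma> / \<eta>"
  have K: "0 < K" "2 * K < \<eta>"
  proof -
    show "0 < K" using \<sigma> \<eta> by (simp add: K_def)
    have "\<sigma> \<le> \<eta>\<^sup>2 / 32" by (simp add: \<sigma>_def)
    then have "2 * K \<le> \<eta> / 2" using \<eta> by (simp add: K_def field_simps power2_eq_square)
    then show "2 * K < \<eta>" using \<eta> by simp
  qed
  have step: "norm (x (Suc n) - x n) \<le> K * (1/2)^n" for n
  proof -
    have "W (Suc n) (x (Suc n) - x n) \<le> s n"
      using dec[of n] xmin[OF xS[of "Suc n"], of n] W0[of "Suc n"] by (simp add: TS)
    then have "a (Suc n) * norm (x (Suc n) - x n) \<le> s n + s (Suc n)"
      using W(3)[of "Suc n" "x (Suc n) - x n"] by linarith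
    also have "\<dots> \<le> 2 * s n" using \<sigma> by (simp add: s_def)
    also have "\<dots> = a (Suc n) * (K * (1/2)^n)"
    proof -
      have "(1/4::real)^n = (1/2)^n * (1/2)^n" by (simp flip: power_mult_distrib)
      then show ?thesis using \<eta> by (simp add: s_def a_def K_def)
    qed
    finally show ?thesis using a[of "Suc n"] by simp
  qed
  have Ksums: "(\<lambda>n. K * (1/2)^n) sums (2 * K)"
    using sums_mult[OF geometric_sums[of "1/2::real"], of K] by (simp add: mult.commute)
  have sd: "summable (\<lambda>n. x (Suc n) - x n)"
    by (rule summable_comparison_test'[OF sums_summable[OF Ksums]]) (rule step)
  define l where "l = xh + (\<Sum>n. x (Suc n) - x n)"
  have tele: "(\<Sum>i<n. x (Suc i) - x i) = x n - xh" for n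
    using sum_lessThan_telescope[of x n] x0 by simp
  have lim: "x \<longlonglongrightarrow> l"
  proof -
    have "(\<lambda>n. xh + (\<Sum>i<n. x (Suc i) - x i)) \<longlonglongrightarrow> l"
      unfolding l_def by (intro tendsto_intros summable_LIMSEQ sd)
    then show ?thesis by (simp add: tele)
  qed
  have dist_n: "norm (x n - xh) \<le> 2 * K" for n
  proof -
    have "norm (x n - xh) \<le> (\<Sum>i<n. norm (x (Suc i) - x i))"
      unfolding tele[symmetric] by (rule norm_sum)
    also have "\<dots> \<le> (\<Sum>i<n. K * (1/2)^i)" by (intro sum_mono step)
    also have "\<dots> \<le> 2 * K"
      using sum_le_suminf[OF sums_summable[OF Ksums], of "{..<n}"] K sums_unique[OF Ksums] by simp
    finally show ?thesis .
  qed
  have l_near: "norm (l - xh) < \<eta>"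
  proof -
    have "norm (l - xh) \<le> 2 * K"
      by (rule LIMSEQ_le_const2[OF tendsto_norm[OF tendsto_diff[OF lim tendsto_const]]]) (use dist_n in auto)
    then show ?thesis using K by linarith
  qed
  have lY: "l \<in> Y"
    using closed_sequentially[OF Y(2) _ lim] xS by (auto simp: S_def)
  \<comment> \<open>\<open>y n\<close> is the centre of \<open>W n\<close>: the sequence shifted by
    one with \<open>xh\<close> in front, so that \<open>xh = x 0\<close> serves as a centre
    twice.\<close>
  define y where "y n = (case n of 0 \<Rightarrow> xh | Suc m \<Rightarrow> x m)" for n
  have yY: "y n \<in> Y" for n using xS xh(1) by (auto simp: y_def S_def split: nat.splits)
  have y_near: "norm (y n - xh) \<le> 2 * K" for n
    using dist_n K(1) by (auto simp: y_def split: nat.splits)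
  have T_sum: "T n z = (\<Sum>i<Suc n. W i (z - y i))" for n z
    by (induction n) (auto simp: T0 TS y_def)
  have sW: "summable (\<lambda>i. W i (z - y i))" for z
  proof (rule summable_comparison_test')
    show "summable (\<lambda>i. a i * (norm (z - xh) + 2 * K) + s i)"
      by (intro summable_add summable_mult2 sums_summable[OF a_sums] sums_summable[OF s_sums])
    show "norm (W i (z - y i)) \<le> a i * (norm (z - xh) + 2 * K) + s i" for i
    proof -
      have "norm (z - y i) \<le> norm (z - xh) + 2 * K"
        using y_near[of i] norm_triangle_ineq[of "z - xh" "xh - y i"] by (simp add: norm_minus_commute)
      then have "a i * norm (z - y i) \<le> a i * (norm (z - xh) + 2 * K)"
        using a[of i] by (intro mult_left_mono) auto
      moreover have "0 \<le> a i * norm (z - y i)" using a[of i] by simp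
      ultimately show ?thesis using W(2)[of i "z - y i"] Wlow[of i "z - y i"] s[of i] by (simp add: abs_le_iff)
    qed
  qed
  define R where "R z = (\<Sum>i. W i (z - y i))" for z
  have smoothR: "smooth_along Y (c + \<eta>) R"
    unfolding R_def using smooth_along_suminf[OF Y(1) W(1) yY sums_summable[OF a_sums] less_imp_le[OF a] sW]
    by (simp add: sums_unique[OF a_sums, symmetric])
  have TR: "(\<lambda>n. T n z) \<longlonglongrightarrow> R z" for z
    unfolding T_sum R_def by (rule LIMSEQ_Suc[OF summable_LIMSEQ[OF sW]])
  \<comment> \<open>The \<open>W i\<close> may be slightly negative, so \<open>T n\<close> need not
    lie below \<open>R\<close>; the bounds \<open>- s i\<close> beyond index \<open>n\<close>
    measure by how much this can fail.\<close>
  define tl where "tl n = (\<Sum>i. s (i + Suc n))" for n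
  have tl: "tl \<longlonglongrightarrow> 0"
    unfolding tl_def by (rule LIMSEQ_Suc[OF suminf_exist_split2[OF sums_summable[OF s_sums]]])
  have R_ge: "T n z - tl n \<le> R z" for n z
  proof -
    have "- tl n = (\<Sum>i. - s (i + Suc n))"
      unfolding tl_def by (rule suminf_minus[symmetric]) (simp add: summable_iff_shift[of s "Suc n"] sums_summable[OF s_sums] del: add_Suc_right)
    also have "\<dots> \<le> (\<Sum>i. W (i + Suc n) (z - y (i + Suc n)))"
      using summable_ignore_initial_segment[OF sW[of z], of "Suc n"]
        summable_ignore_initial_segment[OF sums_summable[OF s_sums], of "Suc n"]
      by (intro suminf_le Wlow summable_minus) auto
    finally show ?thesis
      using suminf_split_initial_segment[OF sW[of z], of "Suc n"] unfolding R_def T_sum by linarith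
  qed
  have R_low: "- (\<sigma> * (4/3)) \<le> R z" for z
  proof -
    have "(\<Sum>i. - s i) \<le> R z"
      unfolding R_def by (intro suminf_le Wlow summable_minus sW sums_summable[OF s_sums])
    then show ?thesis using suminf_minus[OF sums_summable[OF s_sums]] sums_unique[OF s_sums] by simp
  qed
  have T_lip: "T n (z + h) \<le> T n z + (c + \<eta>) * norm h" for n z h
  proof -
    have "T n (z + h) \<le> (\<Sum>i<Suc n. W i (z - y i) + a i * norm h)"
      unfolding T_sum
    proof (rule sum_mono)
      show "W i (z + h - y i) \<le> W i (z - y i) + a i * norm h" for i
        using W(1)[of i] unfolding smooth_along_def by (metis add_diff_eq add.commute diff_add_eq)
    qed
    also have "\<dots> = T n z + (\<Sum>i<Suc n. a i) * norm h"
      unfolding T_sum by (simp only: sum.distrib sum_distrib_right)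
    also have "\<dots> \<le> T n z + (c + \<eta>) * norm h"
      using sum_le_suminf[OF sums_summable[OF a_sums], of "{..<Suc n}"] a sums_unique[OF a_sums]
      by (intro add_left_mono mult_right_mono) (auto intro: less_imp_le)
    finally show ?thesis .
  qed
  have fx: "f (x n) \<le> ereal (B - T n l + (c + \<eta>) * norm (l - x n))"
    if "F (x n) + T n (x n) \<le> B" for n B
    using T_lip[of n "x n" "l - x n"] that fF[OF xS[of n]] by simp
  have err: "(\<lambda>n. (c + \<eta>) * norm (l - x n)) \<longlonglongrightarrow> 0"
    using tendsto_mult_left[OF tendsto_norm[OF tendsto_diff[OF tendsto_const[of l] lim]], of "c + \<eta>"] by simp
  have "f l \<le> ereal (fh - R l + 0)"
  proof (rule lsc_tendsto_le[OF f(1) lim])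
    \<comment> \<open>A new perturbation is at most 0 at its own centre, so the perturbed values
      never rise above \<open>fh\<close>.\<close>
    have "F (x n) + T n (x n) \<le> fh" for n
    proof (induction n)
      case 0
      then show ?case using W0[of 0] by (simp add: x0 T0 Fxh)
    next
      case (Suc n)
      then show ?case using dec[of n] W0[of "Suc n"] by (simp add: TS)
    qed
    then show "f (x n) \<le> ereal (fh - T n l + (c + \<eta>) * norm (l - x n))" for n by (rule fx)
    show "(\<lambda>n. fh - T n l + (c + \<eta>) * norm (l - x n)) \<longlonglongrightarrow> fh - R l + 0"
      by (intro tendsto_intros TR err)
  qed
  then have fl: "f l \<le> ereal (fh - R l)" by simp
  then have lS: "l \<in> S" using lY by (auto simp: S_def)
  have l_val: "f l < ereal (fh + \<eta>)"
  proof -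
    have "\<sigma> * (4/3) < \<eta>" using \<eta> unfolding \<sigma>_def by (simp add: min_def)
    then show ?thesis using fl R_low[of l] fF[OF lS] by simp
  qed
  have l_min: "F l + R l \<le> F u + R u" if u: "u \<in> S" for u
  proof -
    have "f l \<le> ereal (F u + R u + 0 + 0 - R l + 0)"
    proof (rule lsc_tendsto_le[OF f(1) lim])
      show "f (x n) \<le> ereal (F u + R u + s n + tl n - T n l + (c + \<eta>) * norm (l - x n))" for n
        using xmin[OF u, of n] R_ge[of n u] by (intro fx) linarith
      have "s \<longlonglongrightarrow> 0" by (rule summable_LIMSEQ_zero[OF sums_summable[OF s_sums]])
      then show "(\<lambda>n. F u + R u + s n + tl n - T n l + (c + \<eta>) * norm (l - x n)) \<longlonglongrightarrow> F u + R u + 0 + 0 - R l + 0"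
        by (intro tendsto_intros TR err tl)
    qed
    then show ?thesis using fF[OF lS] by simp
  qed
  obtain \<xi> where \<xi>: "norm \<xi> \<le> c + \<eta>" "\<And>r. 0 < r \<Longrightarrow> \<exists>t>0. \<forall>h\<in>Y. norm h < t \<longrightarrow>
      R (l + h) \<le> R l + blinfun_apply \<xi> h + r * norm h"
    using smoothR lY unfolding smooth_along_def by blast
  have "subgrad_on Y f l (- \<xi>)"
    unfolding subgrad_on_def
  proof (intro allI impI)
    fix r :: real assume "0 < r"
    then obtain t where t: "0 < t" "\<And>h. h \<in> Y \<Longrightarrow> norm h < t \<Longrightarrow> R (l + h) \<le> R l + blinfun_apply \<xi> h + r * norm h"
      using \<xi>(2) by blast
    have "f l + ereal (blinfun_apply (- \<xi>) h - r * norm h) \<le> f (l + h)" if h: "h \<in> Y" "norm h < t" for h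
    proof (cases "l + h \<in> S")
      case True
      then show ?thesis using l_min[OF True] t(2)[OF h] fF[OF lS] fF[OF True]
        by (simp add: blinfun.minus_left)
    next
      case False
      then have "f (l + h) = \<infinity>" using subspace_add[OF Y(1) lY h(1)] by (auto simp: S_def)
      then show ?thesis by simp
    qed
    then show "\<exists>s>0. \<forall>h\<in>Y. norm h < s \<longrightarrow> f l + ereal (blinfun_apply (- \<xi>) h - r * norm h) \<le> f (l + h)"
      using t(1) by blast
  qed
  then show thesis using \<xi>(1) by (intro that[OF lY l_near l_val, of "- \<xi>"]) simp_all
qed

section \<open>Separable reduction\<close>

lemma countable_closed_under:
  fixes G :: "'a \<Rightarrow> 'a \<Rightarrow> 'a set"
  assumes "\<And>u v. countable (G u v)"
  obtains C where "countable C" "x \<in> C" "\<And>u v. u \<in> C \<Longrightarrow> v \<in> C \<Longrightarrow> G u v \<subseteq> C"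
proof -
  define step where "step C = C \<union> (\<Union>u\<in>C. \<Union>v\<in>C. G u v)" for C
  define D where "D n = (step ^^ n) {x}" for n
  have D0: "D 0 = {x}" and DS: "D (Suc n) = step (D n)" for n by (simp_all add: D_def)
  have mono: "D m \<subseteq> D n" if "m \<le> n" for m n
    using that by (rule lift_Suc_mono_le[rotated]) (auto simp: DS step_def)
  have "countable (D n)" for n
    by (induction n) (auto simp: D0 DS step_def assms intro!: countable_UN)
  moreover have "G u v \<subseteq> (\<Union>n. D n)" if uv: "u \<in> (\<Union>n. D n)" "v \<in> (\<Union>n. D n)" for u v
  proof -
    obtain m n where "u \<in> D m" "v \<in> D n" using uv by blast
    then have "u \<in> D (max m n)" "v \<in> D (max m n)" using mono[of m "max m n"] mono[of n "max m n"] by auto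
    then have "G u v \<subseteq> D (Suc (max m n))" by (auto simp: DS step_def)
    then show ?thesis by blast
  qed
  ultimately show thesis using D0 by (intro that[of "\<Union>n. D n"]) auto
qed

lemma subspace_closure_rational:
  fixes C :: "'a::real_normed_vector set"
  assumes ne: "C \<noteq> {}"
    and C: "\<And>u v p q. u \<in> C \<Longrightarrow> v \<in> C \<Longrightarrow> of_rat p *\<^sub>R u + of_rat q *\<^sub>R v \<in> C"
  shows "subspace (closure C)"
proof -
  have add: "u + v \<in> closure C" if uv: "u \<in> closure C" "v \<in> closure C" for u v
  proof -
    obtain a b where ab: "\<forall>n. a n \<in> C" "a \<longlonglongrightarrow> u" "\<forall>n. b n \<in> C" "b \<longlonglongrightarrow> v"
      using uv unfolding closure_sequential by blast
    then have "\<forall>n. a n + b n \<in> C" using C[of _ _ 1 1] by auto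
    then show ?thesis unfolding closure_sequential using tendsto_add[OF ab(2,4)]
      by (intro exI[of _ "\<lambda>n. a n + b n"] conjI)
  qed
  have rat: "of_rat p *\<^sub>R u \<in> closure C" if u: "u \<in> closure C" for p u
  proof -
    obtain a where a: "\<forall>n. a n \<in> C" "a \<longlonglongrightarrow> u" using u unfolding closure_sequential by blast
    then have "\<forall>n. of_rat p *\<^sub>R a n \<in> C" using C[of _ _ p 0] by auto
    then show ?thesis unfolding closure_sequential using tendsto_scaleR[OF tendsto_const a(2)]
      by (intro exI[of _ "\<lambda>n. of_rat p *\<^sub>R a n"] conjI)
  qed
  have "r *\<^sub>R u \<in> closure C" if u: "u \<in> closure C" for r u
  proof -
    have "closed ((\<lambda>r. r *\<^sub>R u) -` closure C)"
      by (intro closed_vimage closed_closure continuous_intros)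
    moreover have "\<rat> \<subseteq> (\<lambda>r. r *\<^sub>R u) -` closure C"
      using rat[OF u] by (auto elim: Rats_cases)
    ultimately have "closure \<rat> \<subseteq> (\<lambda>r. r *\<^sub>R u) -` closure C" by (rule closure_minimal[rotated])
    then show ?thesis using Rats_closure_real by auto
  qed
  moreover have "0 \<in> closure C"
  proof -
    obtain u where "u \<in> C" using ne by blast
    then have "0 \<in> C" using C[of u u 0 0] by simp
    then show ?thesis using closure_subset by blast
  qed
  ultimately show ?thesis using add by (simp add: subspace_def)
qed

text \<open>All data besides the base point \<open>v\<close> come from countable types: indices
  \<open>k\<close> for the tolerances \<open>1 / (k + 1)\<close>, rational radii, and a rational
  level \<open>\<beta>\<close> standing in for a multiple of the value of \<open>f\<close> at a
  limit point that is not accessible from \<open>v\<close>. So each \<open>v\<close> requires only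
  countably many choices.\<close>

definition descent_witness ::
  "('a::real_normed_vector \<Rightarrow> ereal) \<Rightarrow> real \<Rightarrow> 'a \<Rightarrow> (nat \<times> rat) list \<Rightarrow> rat \<Rightarrow> 'a list \<Rightarrow> bool" where
  "descent_witness f K v ps \<beta> hs \<longleftrightarrow> length hs = length ps \<and>
    (\<forall>i<length ps. norm (hs ! i) < of_rat (snd (ps ! i)) \<and> f (v + hs ! i) \<noteq> \<infinity>) \<and>
    (\<Sum>i<length ps. real_of_ereal (f (v + hs ! i)) + norm (hs ! i) / (real (fst (ps ! i)) + 1))
      + K * norm (\<Sum>i<length ps. hs ! i) < of_rat \<beta>"

text \<open>By \<open>mazur_orlicz\<close>, the absence of a subgradient of norm at most \<open>K\<close> at a point is witnessed by
  finite lists; a countable set closed under choosing such lists at its own points captures the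
  witnesses for all points of its closure, since a witness at \<open>x\<close> translates to nearby points.\<close>

lemma separable_reduction:
  fixes f :: "'a::real_normed_vector \<Rightarrow> ereal"
  assumes f: "\<And>x. f x \<noteq> -\<infinity>" and K: "0 \<le> K"
  obtains Y C where "subspace Y" "closed Y" "countable C" "C \<subseteq> Y" "Y \<subseteq> closure C" "x0 \<in> Y"
    "\<And>x y'. x \<in> Y \<Longrightarrow> f x \<noteq> \<infinity> \<Longrightarrow> norm y' \<le> K \<Longrightarrow> subgrad_on Y f x y' \<Longrightarrow>
      \<exists>x'. norm x' \<le> K \<and> subgrad_on UNIV f x x'"
proof -
  define F where "F u = real_of_ereal (f u)" for u
  have fF: "f u = ereal (F u)" if "f u \<noteq> \<infinity>" for u
    using that f[of u] by (cases "f u") (auto simp: F_def)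
  define sk where "sk v ps \<beta> = (SOME hs. descent_witness f K v ps \<beta> hs)" for v ps \<beta>
  define G where "G u v = (\<Union>(p, q)\<in>UNIV. {of_rat p *\<^sub>R u + of_rat q *\<^sub>R v}) \<union> (\<Union>(ps, \<beta>)\<in>UNIV. set (sk u ps \<beta>))" for u v
  have "countable (G u v)" for u v
    unfolding G_def by (intro countable_Un countable_UN) (auto simp: countable_finite)
  then obtain C where C: "countable C" "x0 \<in> C" "\<And>u v. u \<in> C \<Longrightarrow> v \<in> C \<Longrightarrow> G u v \<subseteq> C"
    using countable_closed_under[of G x0] by blast
  define Y where "Y = closure C"
  have Csk: "set (sk u ps \<beta>) \<subseteq> C" if "u \<in> C" for u ps \<beta>
    using C(3)[OF that that] by (force simp: G_def)
  have Y: "subspace Y" unfolding Y_def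
  proof (rule subspace_closure_rational)
    show "C \<noteq> {}" using C(2) by auto
    show "of_rat p *\<^sub>R u + of_rat q *\<^sub>R v \<in> C" if "u \<in> C" "v \<in> C" for u v p q
      using C(3)[OF that] by (force simp: G_def)
  qed
  have CY: "C \<subseteq> Y" by (simp add: Y_def closure_subset)
  show thesis
  proof (rule that[OF Y _ C(1) CY])
    show "closed Y" "Y \<subseteq> closure C" "x0 \<in> Y" using C(2) CY by (auto simp: Y_def)
    fix x y' assume x: "x \<in> Y" "f x \<noteq> \<infinity>" and y': "norm y' \<le> K" and sub: "subgrad_on Y f x y'"
    have "\<exists>s>0. \<forall>h\<in>Y. norm h < s \<longrightarrow> f x + ereal (blinfun_apply y' h - 1 / (real k + 1) * norm h) \<le> f (x + h)" for k
      using sub[unfolded subgrad_on_def, rule_format, of "1 / (real k + 1)"] by (simp add: add_nonneg_pos)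
    then obtain R where R: "\<And>k. 0 < R k"
      and Rsub: "\<And>k h. h \<in> Y \<Longrightarrow> norm h < R k \<Longrightarrow> f x + ereal (blinfun_apply y' h - 1 / (real k + 1) * norm h) \<le> f (x + h)"
      by metis
    define E where "E = {(h, F (x + h) - F x + norm h / (real k + 1)) | h k. norm h < R k / 2 \<and> f (x + h) \<noteq> \<infinity>}"
    have "0 \<le> sum_list (map snd l) + K * norm (sum_list (map fst l))" if l: "set l \<subseteq> E" for l
    proof (rule ccontr)
      assume neg: "\<not> 0 \<le> sum_list (map snd l) + K * norm (sum_list (map fst l))"
      define N where "N = length l"
      define h where "h i = fst (l ! i)" for i
      have "\<exists>k. snd (l ! i) = F (x + h i) - F x + norm (h i) / (real k + 1) \<and> norm (h i) < R k / 2 \<and> f (x + h i) \<noteq> \<infinity>"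
        if "i < N" for i
      proof -
        have "l ! i \<in> E" using l that by (auto simp: N_def)
        then show ?thesis by (auto simp: E_def h_def)
      qed
      then obtain k where k: "\<And>i. i < N \<Longrightarrow> snd (l ! i) = F (x + h i) - F x + norm (h i) / (real (k i) + 1)"
        "\<And>i. i < N \<Longrightarrow> norm (h i) < R (k i) / 2" "\<And>i. i < N \<Longrightarrow> f (x + h i) \<noteq> \<infinity>" by metis
      define S where "S = (\<Sum>i<N. F (x + h i) + norm (h i) / (real (k i) + 1)) + K * norm (\<Sum>i<N. h i)"
      have "sum_list (map snd l) = (\<Sum>i<N. F (x + h i) + norm (h i) / (real (k i) + 1)) - real N * F x"
      proof -
        have "sum_list (map snd l) = (\<Sum>i<N. snd (l ! i))"
          by (simp add: sum_list_sum_nth N_def atLeast0LessThan)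
        also have "\<dots> = (\<Sum>i<N. (F (x + h i) + norm (h i) / (real (k i) + 1)) - F x)"
          by (intro sum.cong) (auto simp: k(1))
        finally show ?thesis by (simp add: sum_subtractf)
      qed
      moreover have "sum_list (map fst l) = (\<Sum>i<N. h i)"
        by (simp add: sum_list_sum_nth N_def atLeast0LessThan h_def)
      ultimately have S: "S < real N * F x" using neg by (simp add: S_def)
      define \<gamma> where "\<gamma> = real N * F x - S"
      have \<gamma>: "0 < \<gamma>" using S by (simp add: \<gamma>_def)
      \<comment> \<open>The first entry makes two changes of the base point, each costing at most
        \<open>w\<close>, fit into the gap \<open>\<gamma>\<close>; the others keep each change
        within an eighth of every radius involved.\<close>
      define \<mu> where "\<mu> = Min (insert (\<gamma> / (4 * (real N + 1) * (1 + K))) ((\<lambda>i. R (k i) / 8) ` {..<N}))"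
      have \<mu>: "0 < \<mu>" using R \<gamma> K by (auto simp: \<mu>_def)
      have \<mu>R: "\<mu> \<le> R (k i) / 8" if "i < N" for i
        unfolding \<mu>_def by (rule Min_le) (use that in auto)
      have "\<mu> \<le> \<gamma> / (4 * (real N + 1) * (1 + K))" by (simp add: \<mu>_def)
      moreover have "0 < 4 * (real N + 1) * (1 + K)" using K by simp
      ultimately have "\<mu> * (4 * (real N + 1) * (1 + K)) \<le> \<gamma>" by (simp only: pos_le_divide_eq)
      moreover have "real N * (1 + K) * \<mu> \<le> (real N + 1) * (1 + K) * \<mu>"
        using K \<mu> by (intro mult_right_mono) auto
      ultimately have small: "4 * (real N * (1 + K) * \<mu>) \<le> \<gamma>" by (simp add: algebra_simps)
      define w where "w = real N * (1 + K) * \<mu>"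
      have w_eq: "w = real N * \<mu> + K * (real N * \<mu>)" by (simp add: w_def algebra_simps)
      obtain v where v: "v \<in> C" "norm (v - x) < \<mu>"
        using closure_approachable[THEN iffD1, rule_format, OF x(1)[unfolded Y_def] \<mu>] by (auto simp: dist_norm)
      \<comment> \<open>The rational radius sits between \<open>5/8 = 1/2 + 1/8\<close> and
        \<open>7/8 = 1 - 1/8\<close> of \<open>R j\<close>: large enough for the vectors shifted to
        \<open>v\<close>, small enough to shift back to \<open>x\<close> within
        \<open>R j\<close>.\<close>
      have "\<exists>\<rho>::rat. 5 / 8 * R j < of_rat \<rho> \<and> of_rat \<rho> < 7 / 8 * R j" for j
        using R[of j] by (intro of_rat_dense) simp
      then obtain \<rho> :: "nat \<Rightarrow> rat" where \<rho>: "\<And>j. 5 / 8 * R j < of_rat (\<rho> j)" "\<And>j. of_rat (\<rho> j) < 7 / 8 * R j"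
        by metis
      have "S + w < real N * F x - w" using small[folded w_def] \<gamma> unfolding \<gamma>_def by linarith
      then obtain \<beta> :: rat where \<beta>: "S + w < of_rat \<beta>" "of_rat \<beta> < real N * F x - w"
        using of_rat_dense by blast
      define ps where "ps = map (\<lambda>i. (k i, \<rho> (k i))) [0..<N]"
      have ps: "length ps = N" "\<And>i. i < N \<Longrightarrow> ps ! i = (k i, \<rho> (k i))" by (simp_all add: ps_def)
      have shift: "(\<Sum>i<N. norm (a i + z) / (real (k i) + 1)) \<le> (\<Sum>i<N. norm (a i) / (real (k i) + 1)) + real N * \<mu>"
        "norm (\<Sum>i<N. a i + z) \<le> norm (\<Sum>i<N. a i) + real N * \<mu>"
        if z: "norm z < \<mu>" for a :: "nat \<Rightarrow> 'a" and z
      proof -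
        have "norm (a i + z) / (real (k i) + 1) \<le> norm (a i) / (real (k i) + 1) + \<mu>" for i
        proof -
          have "norm (a i + z) \<le> norm (a i) + \<mu>" using norm_triangle_ineq[of "a i" z] z by linarith
          also have "\<dots> \<le> norm (a i) + \<mu> * (real (k i) + 1)" using \<mu> by (simp add: algebra_simps)
          finally have "norm (a i + z) / (real (k i) + 1) \<le> (norm (a i) + \<mu> * (real (k i) + 1)) / (real (k i) + 1)"
            by (rule divide_right_mono) simp
          moreover have "real (k i) + 1 \<noteq> 0" by linarith
          ultimately show ?thesis by (simp add: add_divide_distrib)
        qed
        then have "(\<Sum>i<N. norm (a i + z) / (real (k i) + 1)) \<le> (\<Sum>i<N. norm (a i) / (real (k i) + 1) + \<mu>)"
          by (intro sum_mono) auto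
        then show "(\<Sum>i<N. norm (a i + z) / (real (k i) + 1)) \<le> (\<Sum>i<N. norm (a i) / (real (k i) + 1)) + real N * \<mu>"
          by (simp add: sum.distrib)
        have "norm (\<Sum>i<N. a i + z) \<le> norm (\<Sum>i<N. a i) + real N * norm z"
          using norm_triangle_ineq[of "\<Sum>i<N. a i" "real N *\<^sub>R z"] by (simp add: sum.distrib sum_constant_scaleR)
        also have "\<dots> \<le> norm (\<Sum>i<N. a i) + real N * \<mu>"
          using z by (intro add_left_mono mult_left_mono) auto
        finally show "norm (\<Sum>i<N. a i + z) \<le> norm (\<Sum>i<N. a i) + real N * \<mu>" .
      qed
      have xv: "norm (x - v) < \<mu>" using v(2) by (simp add: norm_minus_commute)
      \<comment> \<open>Adding \<open>x - v\<close> to every \<open>h i\<close> leaves the points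
        \<open>x + h i\<close>, hence the values of \<open>f\<close>, unchanged; only the norm terms
        move, by at most \<open>w\<close> in total.\<close>
      have "descent_witness f K v ps \<beta> (map (\<lambda>i. h i + (x - v)) [0..<N])"
        unfolding descent_witness_def ps(1)
      proof (intro conjI allI impI)
        fix i assume i: "i < N"
        have "norm (h i + (x - v)) < R (k i) / 2 + R (k i) / 8"
          using norm_triangle_ineq[of "h i" "x - v"] k(2)[OF i] xv \<mu>R[OF i] by linarith
        then show "norm (map (\<lambda>i. h i + (x - v)) [0..<N] ! i) < of_rat (snd (ps ! i))"
          using i \<rho>(1)[of "k i"] by (simp add: ps)
        show "f (v + map (\<lambda>i. h i + (x - v)) [0..<N] ! i) \<noteq> \<infinity>" using i k(3)[OF i] by (simp add: algebra_simps)
      next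
        have "(\<Sum>i<N. F (x + h i) + norm (h i + (x - v)) / (real (k i) + 1)) + K * norm (\<Sum>i<N. h i + (x - v)) \<le> S + w"
          using shift(1)[OF xv, of h] mult_left_mono[OF shift(2)[OF xv, of h] K]
          by (simp add: S_def w_eq sum.distrib distrib_left)
        then have "(\<Sum>i<N. F (x + h i) + norm (h i + (x - v)) / (real (k i) + 1)) + K * norm (\<Sum>i<N. h i + (x - v)) < of_rat \<beta>"
          using \<beta>(1) by linarith
        moreover have "(\<Sum>i<N. real_of_ereal (f (v + map (\<lambda>i. h i + (x - v)) [0..<N] ! i)) +
            norm (map (\<lambda>i. h i + (x - v)) [0..<N] ! i) / (real (fst (ps ! i)) + 1))
          = (\<Sum>i<N. F (x + h i) + norm (h i + (x - v)) / (real (k i) + 1))"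
          by (intro sum.cong) (auto simp: ps F_def algebra_simps)
        moreover have "(\<Sum>i<N. map (\<lambda>i. h i + (x - v)) [0..<N] ! i) = (\<Sum>i<N. h i + (x - v))"
          by (intro sum.cong) auto
        ultimately show "(\<Sum>i<N. real_of_ereal (f (v + map (\<lambda>i. h i + (x - v)) [0..<N] ! i)) +
            norm (map (\<lambda>i. h i + (x - v)) [0..<N] ! i) / (real (fst (ps ! i)) + 1))
          + K * norm (\<Sum>i<N. map (\<lambda>i. h i + (x - v)) [0..<N] ! i) < of_rat \<beta>" by simp
      qed simp
      then have "descent_witness f K v ps \<beta> (sk v ps \<beta>)" unfolding sk_def by (rule someI)
      then obtain hs where hs: "descent_witness f K v ps \<beta> hs" "set hs \<subseteq> C" using Csk[OF v(1)] by blast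
      have len: "length hs = N" and hn: "\<And>i. i < N \<Longrightarrow> norm (hs ! i) < of_rat (\<rho> (k i))"
        and hf: "\<And>i. i < N \<Longrightarrow> f (v + hs ! i) \<noteq> \<infinity>"
        using hs(1) by (auto simp: descent_witness_def ps)
      have "(\<Sum>i<N. real_of_ereal (f (v + hs ! i)) + norm (hs ! i) / (real (fst (ps ! i)) + 1))
          = (\<Sum>i<N. F (v + hs ! i) + norm (hs ! i) / (real (k i) + 1))"
        by (intro sum.cong) (auto simp: ps F_def)
      then have hb: "(\<Sum>i<N. F (v + hs ! i) + norm (hs ! i) / (real (k i) + 1)) + K * norm (\<Sum>i<N. hs ! i) < of_rat \<beta>"
        using hs(1) by (simp add: descent_witness_def ps(1))
      \<comment> \<open>Shifting the selected vectors, which lie in \<open>C\<close>, back to the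
        base point \<open>x\<close> gives increments in \<open>Y\<close>, where \<open>y'\<close>
        may be used; summing its inequalities contradicts the choice of
        \<open>\<beta>\<close>.\<close>
      define g where "g i = hs ! i + (v - x)" for i
      have gY: "g i \<in> Y" if "i < N" for i
      proof -
        have "hs ! i \<in> set hs" using len that by simp
        then have "hs ! i \<in> Y" "v \<in> Y" using hs(2) v(1) CY by blast+
        then show ?thesis unfolding g_def by (intro subspace_add subspace_diff Y x(1))
      qed
      have gsub: "F x + blinfun_apply y' (g i) \<le> F (v + hs ! i) + norm (g i) / (real (k i) + 1)" if i: "i < N" for i
      proof -
        have "norm (g i) < R (k i)"
          using norm_triangle_ineq[of "hs ! i" "v - x"] hn[OF i] v(2) \<mu>R[OF i] \<rho>(2)[of "k i"] unfolding g_def by linarith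
        moreover have xg: "x + g i = v + hs ! i" by (simp add: g_def)
        ultimately have "ereal (F x) + ereal (blinfun_apply y' (g i) - 1 / (real (k i) + 1) * norm (g i)) \<le> ereal (F (v + hs ! i))"
          using Rsub[OF gY[OF i], of "k i"] unfolding fF[OF x(2)] xg fF[OF hf[OF i]] by blast
        then show ?thesis by simp
      qed
      have "real N * F x + blinfun_apply y' (\<Sum>i<N. g i) = (\<Sum>i<N. F x + blinfun_apply y' (g i))"
        by (simp add: sum.distrib blinfun.sum_right)
      also have "\<dots> \<le> (\<Sum>i<N. F (v + hs ! i) + norm (g i) / (real (k i) + 1))"
        by (intro sum_mono gsub) simp
      also have "\<dots> \<le> (\<Sum>i<N. F (v + hs ! i) + norm (hs ! i) / (real (k i) + 1)) + real N * \<mu>"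
        using shift(1)[OF v(2), of "\<lambda>i. hs ! i"] by (simp add: g_def sum.distrib)
      finally have "real N * F x + blinfun_apply y' (\<Sum>i<N. g i) \<le> \<dots>" .
      moreover have "- (K * norm (\<Sum>i<N. g i)) \<le> blinfun_apply y' (\<Sum>i<N. g i)"
        using blinfun_le_norm[OF y', of "\<Sum>i<N. g i"] by (simp add: abs_le_iff)
      moreover have "K * norm (\<Sum>i<N. g i) \<le> K * (norm (\<Sum>i<N. hs ! i) + real N * \<mu>)"
        unfolding g_def by (rule mult_left_mono[OF shift(2)[OF v(2)] K])
      ultimately have "real N * F x \<le> (\<Sum>i<N. F (v + hs ! i) + norm (hs ! i) / (real (k i) + 1)) + K * norm (\<Sum>i<N. hs ! i) + w"
        by (simp add: w_eq distrib_left)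
      then show False using hb \<beta>(2) by linarith
    qed
    then obtain x' where x': "norm x' \<le> K" "\<And>h s. (h, s) \<in> E \<Longrightarrow> blinfun_apply x' h \<le> s"
      using mazur_orlicz[OF K] by blast
    have "subgrad_on UNIV f x x'"
      unfolding subgrad_on_def
    proof (intro allI impI)
      fix r :: real assume r: "0 < r"
      obtain k where k: "inverse (real (Suc k)) < r" using reals_Archimedean[OF r] by blast
      have "f x + ereal (blinfun_apply x' h - r * norm h) \<le> f (x + h)" if h: "norm h < R k / 2" for h
      proof (cases "f (x + h) = \<infinity>")
        case False
        then have "(h, F (x + h) - F x + norm h / (real k + 1)) \<in> E" using h by (auto simp: E_def)
        from x'(2)[OF this] have "F x + blinfun_apply x' h - norm h / (real k + 1) \<le> F (x + h)" by simp
        moreover have "norm h / (real k + 1) \<le> r * norm h"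
          using mult_right_mono[OF less_imp_le[OF k] norm_ge_zero[of h]] by (simp add: divide_inverse mult.commute add.commute)
        ultimately show ?thesis using fF[OF x(2)] fF[OF False] by simp
      qed simp
      then show "\<exists>s>0. \<forall>h\<in>UNIV. norm h < s \<longrightarrow> f x + ereal (blinfun_apply x' h - r * norm h) \<le> f (x + h)"
        using R[of k] by (intro exI[of _ "R k / 2"]) auto
    qed
    then show "\<exists>x'. norm x' \<le> K \<and> subgrad_on UNIV f x x'" using x'(1) by blast
  qed
qed

section \<open>Ekeland points and subgradients\<close>

text \<open>Each \<open>x (Suc n)\<close> nearly minimises \<open>F\<close> among the
  \<open>u\<close> with \<open>F u + \<kappa> * norm (u - x n) \<le> F (x n)\<close>. These
  conditions are transitive, so the limit \<open>l\<close> inherits them, and a point violating the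
  conclusion would satisfy all of them, forcing \<open>F l \<le> F u\<close> in the limit.\<close>

lemma ekeland:
  fixes f :: "'a::banach \<Rightarrow> ereal"
  assumes f: "lsc f" "\<And>u. 0 \<le> f u" and x0: "f x0 \<noteq> \<infinity>" and \<kappa>: "0 < \<kappa>"
  obtains l where "f l + ereal (\<kappa> * norm (l - x0)) \<le> f x0" "\<And>u. f l \<le> f u + ereal (\<kappa> * norm (u - l))"
proof -
  define F where "F u = real_of_ereal (f u)" for u
  define D where "D = {u. f u \<noteq> \<infinity>}"
  have fF: "f u = ereal (F u)" if "u \<in> D" for u
    using that f(2)[of u] by (cases "f u") (auto simp: D_def F_def)
  have Fpos: "0 \<le> F u" for u using f(2)[of u] by (simp add: F_def real_of_ereal_pos)
  define P where "P n x \<longleftrightarrow> x \<in> D \<and> (n = 0 \<longrightarrow> x = x0)" for n :: nat and x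
  define Q where "Q n x x' \<longleftrightarrow> F x' + \<kappa> * norm (x' - x) \<le> F x \<and>
    (\<forall>u\<in>D. F u + \<kappa> * norm (u - x) \<le> F x \<longrightarrow> F x' \<le> F u + (1/2)^n)" for n :: nat and x x'
  have "\<exists>x. \<forall>n. P n (x n) \<and> Q n (x n) (x (Suc n))"
  proof (rule dependent_nat_choice)
    show "\<exists>x. P 0 x" using x0 by (auto simp: P_def D_def)
    fix x n assume "P n x"
    then have x: "x \<in> {u\<in>D. F u + \<kappa> * norm (u - x) \<le> F x}" by (auto simp: P_def)
    obtain x' where "x' \<in> {u\<in>D. F u + \<kappa> * norm (u - x) \<le> F x}"
      "\<And>u. u \<in> {u\<in>D. F u + \<kappa> * norm (u - x) \<le> F x} \<Longrightarrow> F x' \<le> F u + (1/2)^n"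
      by (rule approximate_minimum[OF x, of 0 F "(1/2)^n"]) (use Fpos in auto)
    then show "\<exists>x'. P (Suc n) x' \<and> Q n x x'" by (auto simp: P_def Q_def)
  qed
  then obtain x where x: "\<And>n. P n (x n)" "\<And>n. Q n (x n) (x (Suc n))" by blast
  have xD: "x n \<in> D" and x00: "x 0 = x0" for n using x(1)[of n] x(1)[of 0] by (auto simp: P_def)
  have chain: "F (x (n + k)) + \<kappa> * norm (x (n + k) - x n) \<le> F (x n)" for n k
  proof (induction k)
    case (Suc k)
    have "\<kappa> * norm (x (n + Suc k) - x n) \<le> \<kappa> * (norm (x (Suc (n + k)) - x (n + k)) + norm (x (n + k) - x n))"
      using \<kappa> norm_triangle_ineq[of "x (Suc (n + k)) - x (n + k)" "x (n + k) - x n"] by (intro mult_left_mono) auto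
    then show ?case using Suc x(2)[of "n + k"] by (simp add: Q_def distrib_left)
  qed simp
  have mono: "F (x m) \<le> F (x n)" if "n \<le> m" for n m
  proof -
    have "0 \<le> \<kappa> * norm (x (n + (m - n)) - x n)" using \<kappa> by simp
    then show ?thesis using chain[of n "m - n"] that by simp
  qed
  have "convergent (\<lambda>n. F (x n))"
    by (rule Bseq_monoseq_convergent) (auto simp: monoseq_def Bseq_def abs_of_nonneg[OF Fpos]
      intro!: mono exI[of _ "F (x 0) + 1"] add_nonneg_pos Fpos intro: order.trans[OF mono[of 0]])
  then have CF: "Cauchy (\<lambda>n. F (x n))" by (rule convergent_Cauchy)
  have "Cauchy x"
  proof (rule metric_CauchyI)
    fix e :: real assume e: "0 < e"
    then obtain M where M: "\<And>m n. M \<le> m \<Longrightarrow> M \<le> n \<Longrightarrow> dist (F (x m)) (F (x n)) < \<kappa> * e"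
      using metric_CauchyD[OF CF, of "\<kappa> * e"] \<kappa> by auto
    have less: "norm (x m - x n) < e" if "M \<le> n" "n \<le> m" for m n
    proof -
      have "\<kappa> * norm (x m - x n) \<le> F (x n) - F (x m)" using chain[of n "m - n"] that by simp
      also have "\<dots> < \<kappa> * e" using M[of m n] that by (simp add: dist_real_def)
      finally show ?thesis using \<kappa> by simp
    qed
    have "dist (x m) (x n) < e" if "M \<le> m" "M \<le> n" for m n
      using less[of n m] less[of m n] that by (cases "n \<le> m") (auto simp: dist_norm norm_minus_commute)
    then show "\<exists>M. \<forall>m\<ge>M. \<forall>n\<ge>M. dist (x m) (x n) < e" by blast
  qed
  then obtain l where l: "x \<longlonglongrightarrow> l" using Cauchy_convergent convergent_def by blast
  have fl: "f l \<le> ereal (F (x k) - \<kappa> * norm (l - x k))" for k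
  proof (rule lsc_tendsto_le[OF f(1)])
    show "(\<lambda>n. x (k + n)) \<longlonglongrightarrow> l" using LIMSEQ_ignore_initial_segment[OF l, of k] by (simp add: add.commute)
    then show "(\<lambda>n. F (x k) - \<kappa> * norm (x (k + n) - x k)) \<longlonglongrightarrow> F (x k) - \<kappa> * norm (l - x k)"
      by (intro tendsto_intros)
    show "f (x (k + n)) \<le> ereal (F (x k) - \<kappa> * norm (x (k + n) - x k))" for n
      using chain[of k n] fF[OF xD] by simp
  qed
  have lD: "l \<in> D" using fl[of 0] by (auto simp: D_def)
  have Fl: "F l + \<kappa> * norm (l - x k) \<le> F (x k)" for k using fl[of k] fF[OF lD] by simp
  show thesis
  proof (rule that)
    show "f l + ereal (\<kappa> * norm (l - x0)) \<le> f x0"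
      using Fl[of 0] fF[OF lD] fF[OF xD[of 0]] by (simp add: x00)
    fix u
    show "f l \<le> f u + ereal (\<kappa> * norm (u - l))"
    proof (cases "u \<in> D")
      case True
      have "F l \<le> F u + \<kappa> * norm (u - l)"
      proof (rule ccontr)
        assume "\<not> ?thesis"
        then have less: "F u + \<kappa> * norm (u - l) < F l" by simp
        have "F l \<le> F u + (1/2)^k" for k
        proof -
          have "\<kappa> * norm (u - x k) \<le> \<kappa> * (norm (u - l) + norm (l - x k))"
            using \<kappa> norm_triangle_ineq[of "u - l" "l - x k"] by (intro mult_left_mono) auto
          then have "F u + \<kappa> * norm (u - x k) \<le> F (x k)" using less Fl[of k] by (simp add: distrib_left)
          then have "F (x (Suc k)) \<le> F u + (1/2)^k" using x(2)[of k] True by (auto simp: Q_def)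
          moreover have "0 \<le> \<kappa> * norm (l - x (Suc k))" using \<kappa> by simp
          ultimately show ?thesis using Fl[of "Suc k"] by linarith
        qed
        then have "F l \<le> F u + 0"
          by (intro LIMSEQ_le_const[OF tendsto_add[OF tendsto_const LIMSEQ_power_zero[of "1/2::real"]]]) auto
        moreover have "0 \<le> \<kappa> * norm (u - l)" using \<kappa> by simp
        ultimately show False using less by linarith
      qed
      then show ?thesis using fF[OF lD] fF[OF True] by simp
    qed (simp add: D_def)
  qed
qed

text \<open>By Jensen's inequality a list of increments may be replaced by the mean point
  \<open>m\<close>, where minimality at \<open>xh\<close> gives one inequality; multiplied by
  \<open>N\<close> it is the consistency condition of \<open>mazur_orlicz\<close>.\<close>

lemma convex_subgradient:
  fixes f :: "'a::real_normed_vector \<Rightarrow> ereal"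
  assumes f: "ext_convex f" "\<And>u. f u \<noteq> -\<infinity>" and xh: "f xh = ereal fh" and c: "0 \<le> c"
    and min: "\<And>u. ereal (fh - c * norm (u - xh)) \<le> f u"
  obtains x' where "norm x' \<le> c" "subgrad_on UNIV f xh x'"
proof -
  define F where "F u = real_of_ereal (f u)" for u
  define D where "D = {u. f u \<noteq> \<infinity>}"
  have fF: "f u = ereal (F u)" if "u \<in> D" for u
    using that f(2)[of u] by (cases "f u") (auto simp: D_def F_def)
  have Fmin: "fh - c * norm (u - xh) \<le> F u" if "u \<in> D" for u using min[of u] fF[OF that] by simp
  have conv: "f ((1 - t) *\<^sub>R u + t *\<^sub>R v) \<le> ereal ((1 - t) * F u + t * F v)"
    if "u \<in> D" "v \<in> D" "0 \<le> t" "t \<le> 1" for u v t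
    using f(1)[unfolded ext_convex_def, rule_format, of t u v] that fF[OF that(1)] fF[OF that(2)] by simp
  have convD: "convex D"
    unfolding convex_alt using conv by (fastforce simp: D_def)
  have convF: "convex_on D F"
  proof (rule convex_onI[OF _ convD])
    fix t u v assume "0 < t" "t < (1::real)" "u \<in> D" "v \<in> D"
    moreover from this have "(1 - t) *\<^sub>R u + t *\<^sub>R v \<in> D" using convD by (auto simp: convex_alt)
    ultimately show "F ((1 - t) *\<^sub>R u + t *\<^sub>R v) \<le> (1 - t) * F u + t * F v"
      using conv[of u v t] fF[of "(1 - t) *\<^sub>R u + t *\<^sub>R v"] by simp
  qed
  define E where "E = {(h, F (xh + h) - fh) | h. xh + h \<in> D}"
  have "0 \<le> sum_list (map snd l) + c * norm (sum_list (map fst l))" if l: "set l \<subseteq> E" for l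
  proof (cases "l = []")
    case False
    define N where "N = length l"
    have N: "0 < N" using False by (simp add: N_def)
    define h where "h i = fst (l ! i)" for i
    have h: "snd (l ! i) = F (xh + h i) - fh" "xh + h i \<in> D" if "i < N" for i
    proof -
      have "l ! i \<in> E" using l that by (auto simp: N_def)
      then show "snd (l ! i) = F (xh + h i) - fh" "xh + h i \<in> D" by (auto simp: E_def h_def)
    qed
    define m where "m = (\<Sum>i<N. (1 / real N) *\<^sub>R (xh + h i))"
    have m: "m = xh + (1 / real N) *\<^sub>R (\<Sum>i<N. h i)"
      using N by (simp add: m_def scaleR_add_right sum.distrib sum_constant_scaleR flip: scaleR_sum_right)
    have "m \<in> D" unfolding m_def using N h convD by (intro convex_sum) auto
    then have "fh - c * norm (m - xh) \<le> F m" by (rule Fmin)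
    moreover have "F m \<le> (\<Sum>i<N. (1 / real N) * F (xh + h i))"
      unfolding m_def using N h by (intro convex_on_sum[OF _ _ convF]) auto
    moreover have "norm (m - xh) = norm (\<Sum>i<N. h i) / real N" by (simp add: m)
    ultimately have "fh - c * (norm (\<Sum>i<N. h i) / real N) \<le> (\<Sum>i<N. F (xh + h i)) / real N"
      by (simp flip: sum_divide_distrib)
    from mult_left_mono[OF this, of "real N"]
    have "real N * fh - c * norm (\<Sum>i<N. h i) \<le> (\<Sum>i<N. F (xh + h i))"
      using N by (simp add: right_diff_distrib)
    moreover have "sum_list (map snd l) = (\<Sum>i<N. F (xh + h i)) - real N * fh"
      by (simp add: sum_list_sum_nth N_def[symmetric] atLeast0LessThan h(1) sum_subtractf)
    moreover have "sum_list (map fst l) = (\<Sum>i<N. h i)"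
      by (simp add: sum_list_sum_nth N_def atLeast0LessThan h_def)
    ultimately show ?thesis by simp
  qed simp
  then obtain x' where x': "norm x' \<le> c" "\<And>h s. (h, s) \<in> E \<Longrightarrow> blinfun_apply x' h \<le> s"
    using mazur_orlicz[OF c] by blast
  have "f xh + ereal (blinfun_apply x' h - r * norm h) \<le> f (xh + h)" if "0 < r" for r h
  proof (cases "xh + h \<in> D")
    case True
    then have "(h, F (xh + h) - fh) \<in> E" by (auto simp: E_def)
    moreover have "0 \<le> r * norm h" using that by simp
    ultimately show ?thesis using x'(2)[of h "F (xh + h) - fh"] fF[OF True] xh by simp
  qed (simp add: D_def)
  then have "subgrad_on UNIV f xh x'" unfolding subgrad_on_def by (meson zero_less_one)
  then show thesis using that x'(1) by blast
qed

text \<open>In the Asplund case \<open>Y\<close> is built for the bound \<open>c + \<eta>\<close>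
  before the point of the subgradient is known, so that a subgradient along \<open>Y\<close> found
  afterwards lifts. In the convex case \<open>xh\<close> itself serves.\<close>

lemma fuzzy_subgradient:
  fixes f :: "'a::banach \<Rightarrow> ereal"
  assumes f: "lsc f" "\<And>u. f u \<noteq> -\<infinity>" and ac: "asplund TYPE('a) \<or> ext_convex f"
    and xh: "f xh = ereal fh" and c: "0 \<le> c" and \<eta>: "0 < \<eta>"
    and min: "\<And>u. ereal (fh - c * norm (u - xh)) \<le> f u"
  obtains x x' where "norm (x - xh) < \<eta>" "f x < ereal (fh + \<eta>)" "norm x' \<le> c + \<eta>" "subgrad_on UNIV f x x'"
  using ac
proof
  assume asp: "asplund TYPE('a)"
  obtain Y C where Y: "subspace Y" "closed Y" and C: "countable C" "C \<subseteq> Y" "Y \<subseteq> closure C" and xhY: "xh \<in> Y"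
    and rich: "\<And>x y'. x \<in> Y \<Longrightarrow> f x \<noteq> \<infinity> \<Longrightarrow> norm y' \<le> c + \<eta> \<Longrightarrow> subgrad_on Y f x y' \<Longrightarrow>
      \<exists>x'. norm x' \<le> c + \<eta> \<and> subgrad_on UNIV f x x'"
    using separable_reduction[of f "c + \<eta>" xh] f(2) c \<eta> by (metis add_nonneg_nonneg less_imp_le)
  have approx: "\<exists>V. smooth_along Y c V \<and> (\<forall>z. V z \<le> c * norm z) \<and> (\<forall>z. c * norm z - \<sigma> \<le> V z)"
    if "0 < c" "0 < \<sigma>" for c \<sigma>
    using asplund_smooth_approx_norm[OF asp Y(1) C(3,1,2) that] by metis
  obtain x y' where x: "x \<in> Y" "norm (x - xh) < \<eta>" "f x < ereal (fh + \<eta>)" and y': "norm y' \<le> c + \<eta>" "subgrad_on Y f x y'"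
    using smooth_variational_principle[OF Y f xhY xh c \<eta> min approx] by blast
  have "f x \<noteq> \<infinity>" using x(3) by auto
  then show thesis using rich[OF x(1) _ y'] that[OF x(2,3)] by blast
next
  assume "ext_convex f"
  then obtain x' where "norm x' \<le> c" "subgrad_on UNIV f xh x'"
    using convex_subgradient[OF _ f(2) xh c min] by blast
  then show thesis using that[of xh x'] \<eta> xh by simp
qed

section \<open>Positive parts, distances and extended-real powers\<close>

lemma lsc_max_0:
  assumes "lsc f"
  shows "lsc (\<lambda>x. max (f x) 0 :: ereal)"
  unfolding lsc_def le_Liminf_iff
proof (intro allI impI)
  fix x M assume "M < max (f x) 0"
  then consider "M < 0" | "M < f x" by (auto simp: less_max_iff_disj)
  then show "\<forall>\<^sub>F y in at x. M < max (f y) 0"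
  proof cases
    case 2
    then have "\<forall>\<^sub>F y in at x. M < f y"
      using assms unfolding lsc_def le_Liminf_iff by blast
    then show ?thesis by eventually_elim (auto simp: less_max_iff_disj)
  qed (auto simp: less_max_iff_disj)
qed

lemma ext_convex_max_0:
  assumes "ext_convex f"
  shows "ext_convex (\<lambda>x. max (f x) 0)"
  unfolding ext_convex_def
proof (intro allI impI)
  fix x y and t :: real assume t: "0 \<le> t \<and> t \<le> 1"
  have "f ((1 - t) *\<^sub>R x + t *\<^sub>R y) \<le> ereal (1 - t) * f x + ereal t * f y"
    using assms t unfolding ext_convex_def by blast
  also have "\<dots> \<le> ereal (1 - t) * max (f x) 0 + ereal t * max (f y) 0"
    using t by (intro add_mono ereal_mult_left_mono) auto
  finally show "max (f ((1 - t) *\<^sub>R x + t *\<^sub>R y)) 0 \<le> ereal (1 - t) * max (f x) 0 + ereal t * max (f y) 0"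
    using t by (auto intro!: add_nonneg_nonneg ereal_0_le_mult)
qed

text \<open>Lower semicontinuity keeps \<open>f\<close> positive near \<open>x\<close>, so the
  maximum disappears there and the local inequality can be divided by the norm of the
  increment.\<close>

lemma subgrad_max_0_frechet:
  fixes f :: "'a::real_normed_vector \<Rightarrow> ereal"
  assumes f: "lsc f" and x: "0 < f x" "f x \<noteq> \<infinity>" and sub: "subgrad_on UNIV (\<lambda>u. max (f u) 0) x x'"
  shows "x' \<in> frechet_subdiff f x"
proof -
  obtain F where F: "f x = ereal F" using x by (cases "f x") auto
  have "\<forall>\<^sub>F y in at x. M < (f y - f x - ereal (blinfun_apply x' (y - x))) / ereal (norm (y - x))" if M: "M < 0" for M
  proof -
    obtain r where r: "M < ereal r" "ereal r < 0" using ereal_dense2[OF M] by auto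
    then have "0 < - r" by simp
    then obtain s where s: "0 < s" "\<And>h. norm h < s \<Longrightarrow> max (f x) 0 + ereal (blinfun_apply x' h + r * norm h) \<le> max (f (x + h)) 0"
      using sub[unfolded subgrad_on_def, rule_format, of "- r"] by auto
    have "\<forall>\<^sub>F y in at x. 0 < f y"
      using lsc_eventually[OF f x(1)] by (auto simp: eventually_at_filter elim: eventually_mono)
    moreover have "\<forall>\<^sub>F y in at x. norm (y - x) < s \<and> y \<noteq> x"
      using s(1) by (auto simp: eventually_at dist_norm)
    ultimately show ?thesis
    proof eventually_elim
      case (elim y)
      define n where "n = norm (y - x)"
      have n: "0 < n" using elim by (simp add: n_def)
      have le: "ereal (F + (blinfun_apply x' (y - x) + r * n)) \<le> f y"
        using s(2)[of "y - x"] elim x(1) F by (simp add: n_def max_def split: if_splits)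
      have "ereal r \<le> (f y - f x - ereal (blinfun_apply x' (y - x))) / ereal n"
      proof (cases "f y")
        case (real v)
        then have "r * n \<le> v - F - blinfun_apply x' (y - x)" using le by simp
        then show ?thesis using n by (simp add: real F field_simps)
      qed (use n F le in auto)
      then show ?case using r(1) by (simp add: n_def)
    qed
  qed
  then show ?thesis using x F by (simp add: frechet_subdiff_def le_Liminf_iff)
qed

lemma edist_set_eq_infdist:
  assumes "A \<noteq> {}"
  shows "edist_set x A = ereal (infdist x A)"
proof -
  obtain a where a: "a \<in> A" using assms by blast
  have "(INF a\<in>A. ereal (dist x a)) \<le> ereal (dist x a)" by (rule INF_lower[OF a])
  moreover have "0 \<le> (INF a\<in>A. ereal (dist x a))" by (intro INF_greatest) simp
  ultimately have "\<bar>INF a\<in>A. ereal (dist x a)\<bar> \<noteq> \<infinity>" by auto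
  from ereal_INF[OF this] show ?thesis using assms by (simp add: edist_set_def infdist_def)
qed

lemma epow_pos: "0 < t \<Longrightarrow> epow (ereal t) p = ereal (t powr p)"
  by (simp add: epow_def)

lemma epow_nonneg: "0 \<le> epow t p"
  by (auto simp: epow_def)

lemma epow_le:
  assumes "0 \<le> t" "t \<le> ereal b" "0 < p"
  shows "epow t p \<le> ereal (b powr p)"
  using assms by (cases t) (auto simp: epow_def intro: powr_mono2)

section \<open>The error bound\<close>

theorem theorem3p11:
  fixes f :: "'a::banach \<Rightarrow> ereal"
    and xbar :: 'a and \<tau> q :: real and \<delta> :: ereal
  assumes f_proper_range: "\<forall>x. f x \<noteq> -\<infinity>"
    and f_lsc: "lsc f"
    and xbar_in: "f xbar \<le> 0"
    and tau_pos: "\<tau> > 0"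
    and delta_pos: "\<delta> > 0"
    and q_range: "0 < q" "q \<le> 1"
    and asplund_or_convex: "asplund TYPE('a) \<or> ext_convex f"
    and slope_cond: "\<forall>x \<in> eball xbar \<delta> \<inter> {x. f x > 0}.
        epow (f x) q < ereal \<tau> * edist_set x {y. f y \<le> 0} \<longrightarrow>
        epow (edist_set x {y. f y \<le> 0}) (q - 1) * epow (dist_subdiff f x) q \<ge> ereal \<tau>"
  shows "\<forall>\<alpha>. 0 < \<alpha> \<and> \<alpha> < 1 \<longrightarrow> (\<forall>x \<in> eball xbar (\<delta> / ereal (1 + \<alpha>)).
           ereal (\<alpha> powr q * (1 - \<alpha>) powr (1 - q) * \<tau>) * edist_set x {y. f y \<le> 0}
             \<le> epow (max (f x) 0) q)"
proof (intro allI impI ballI)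
  fix \<alpha> :: real and x
  assume \<alpha>': "0 < \<alpha> \<and> \<alpha> < 1" and x_ball: "x \<in> eball xbar (\<delta> / ereal (1 + \<alpha>))"
  have \<alpha>: "0 < \<alpha>" "\<alpha> < 1" using \<alpha>' by auto
  define S where "S = {y. f y \<le> 0}"
  have neS: "S \<noteq> {}" using xbar_in by (auto simp: S_def)
  have es: "edist_set u S = ereal (infdist u S)" for u by (rule edist_set_eq_infdist[OF neS])
  define d where "d = infdist x S"
  define A where "A = \<alpha> powr q * (1 - \<alpha>) powr (1 - q) * \<tau>"
  have A: "0 < A" using \<alpha> tau_pos by (simp add: A_def)
  show "ereal (\<alpha> powr q * (1 - \<alpha>) powr (1 - q) * \<tau>) * edist_set x {y. f y \<le> 0} \<le> epow (max (f x) 0) q"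
    unfolding S_def[symmetric] A_def[symmetric] es d_def[symmetric]
  proof (rule ccontr)
    assume "\<not> ereal A * ereal d \<le> epow (max (f x) 0) q"
    then have less: "epow (max (f x) 0) q < ereal (A * d)" by simp
    then have "0 < A * d" using epow_nonneg[of "max (f x) 0" q] by (metis ereal_less(2) le_less_trans)
    then have d: "0 < d" using A by (simp add: zero_less_mult_iff)
    then have "x \<notin> S" using infdist_zero[of x S] by (auto simp: d_def)
    then have fx: "0 < f x" by (simp add: S_def not_le)
    have "f x \<noteq> \<infinity>" using less q_range by (auto simp: epow_def)
    then obtain M where M: "f x = ereal M" "0 < M" using fx by (cases "f x") auto
    have maxx: "max (f x) 0 = ereal M" using M by (simp add: max_def)
    have Mq: "M powr q < A * d" using less M by (simp add: maxx epow_pos)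
    \<comment> \<open>\<open>\<Theta>\<close> is the level under which the \<open>q\<close>-th power
      of the slope must stay, since the distance of the new point to \<open>S\<close> will exceed
      \<open>(1 - \<alpha>) * d\<close>. Then \<open>A * d\<close> is \<open>\<Theta>\<close> times
      the \<open>q\<close>-th power of \<open>\<alpha> * d\<close>, the radius allowed to Ekeland's
      principle.\<close>
    define \<Theta> where "\<Theta> = \<tau> * ((1 - \<alpha>) * d) powr (1 - q)"
    have \<Theta>: "0 < \<Theta>" using tau_pos \<alpha> d by (simp add: \<Theta>_def)
    have Ad: "A * d = \<Theta> * (\<alpha> * d) powr q"
    proof -
      have "d = d powr (1 - q) * d powr q" using d by (simp flip: powr_add)
      then show ?thesis using \<alpha> d by (simp add: A_def \<Theta>_def powr_mult)
    qed
    have root: "z < B powr (1 / q) \<longleftrightarrow> z powr q < B" if "0 < z" "0 < B" for z B :: real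
    proof -
      have "(B powr (1 / q)) powr q = B" using that q_range by (simp add: powr_powr)
      then show ?thesis using powr_less_mono2[of q z "B powr (1 / q)"] powr_mono2[of q "B powr (1 / q)" z] that q_range
        by (cases "z < B powr (1 / q)") auto
    qed
    obtain M' where M': "M < M'" "M' powr q < A * d"
    proof -
      have "M < (A * d) powr (1 / q)" using root[of M "A * d"] M(2) Mq \<open>0 < A * d\<close> by simp
      then obtain M' where "M < M'" "M' < (A * d) powr (1 / q)" using dense by blast
      then show thesis using that[of M'] root[of M' "A * d"] M(2) \<open>0 < A * d\<close> by simp
    qed
    \<comment> \<open>A total descent below \<open>M'\<close> at this slope permits only a
      displacement smaller than \<open>\<alpha> * d\<close>.\<close>
    define \<kappa> where "\<kappa> = M' / (\<alpha> * d)"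
    have \<kappa>: "0 < \<kappa>" "\<kappa> * (\<alpha> * d) = M'" using M M' \<alpha> d by (auto simp: \<kappa>_def)
    have \<kappa>q: "\<kappa> powr q < \<Theta>"
    proof -
      have "\<kappa> powr q * (\<alpha> * d) powr q = M' powr q" using \<kappa> \<alpha> d by (simp flip: powr_mult)
      then have "\<kappa> powr q * (\<alpha> * d) powr q < \<Theta> * (\<alpha> * d) powr q" using M'(2) Ad by simp
      moreover have "0 < (\<alpha> * d) powr q" using \<alpha> d by simp
      ultimately show ?thesis by (simp add: mult_less_cancel_right)
    qed
    let ?g = "\<lambda>u. max (f u) 0"
    have lscg: "lsc ?g" by (rule lsc_max_0[OF f_lsc])
    obtain xh where xh: "?g xh + ereal (\<kappa> * norm (xh - x)) \<le> ?g x"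
      and xhmin: "\<And>u. ?g xh \<le> ?g u + ereal (\<kappa> * norm (u - xh))"
      using ekeland[OF lscg, of x \<kappa>] \<kappa>(1) maxx by auto
    define r where "r = norm (xh - x)"
    have "?g xh \<noteq> \<infinity>" using xh maxx by auto
    moreover have "0 \<le> ?g xh" by simp
    ultimately obtain fh where fh: "?g xh = ereal fh" "0 \<le> fh" by (cases "?g xh") auto
    have fh_le: "fh + \<kappa> * r \<le> M" using xh by (simp only: fh maxx r_def) simp
    have r: "r < \<alpha> * d"
    proof -
      have "\<kappa> * r < \<kappa> * (\<alpha> * d)" using fh_le fh(2) M' \<kappa>(2) by linarith
      then show ?thesis using \<kappa>(1) by simp
    qed
    have "\<kappa> < \<Theta> powr (1 / q)" using root[OF \<kappa>(1) \<Theta>] \<kappa>q by simp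
    then obtain G where G: "\<kappa> < G" "G < \<Theta> powr (1 / q)" using dense by blast
    \<comment> \<open>In order: \<open>x1\<close> stays within \<open>\<alpha> * d\<close> of
      \<open>x\<close>; its distance to \<open>S\<close> exceeds \<open>\<alpha> * d - r\<close>;
      its value remains below \<open>\<kappa> * (\<alpha> * d - r)\<close>; the norm of the
      subgradient stays at most \<open>G\<close>.\<close>
    define \<eta> where "\<eta> = min (min (\<alpha> * d - r) ((1 - \<alpha>) * d)) (min (M' - M) (G - \<kappa>))"
    have \<eta>: "0 < \<eta>" "\<eta> \<le> \<alpha> * d - r" "\<eta> \<le> (1 - \<alpha>) * d" "\<eta> \<le> M' - M" "\<kappa> + \<eta> \<le> G"
      using r \<alpha> d M' G unfolding \<eta>_def by auto
    have \<kappa>\<eta>: "(\<kappa> + \<eta>) powr q < \<Theta>"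
      using root[of "\<kappa> + \<eta>" \<Theta>] \<Theta> \<eta> \<kappa>(1) G(2) by simp
    have gmin: "ereal (fh - \<kappa> * norm (u - xh)) \<le> ?g u" for u
      using xhmin[of u] unfolding fh by (cases "?g u") auto
    have ac: "asplund TYPE('a) \<or> ext_convex ?g" using asplund_or_convex ext_convex_max_0 by blast
    have gbot: "?g u \<noteq> -\<infinity>" for u using f_proper_range by (simp add: max_def)
    obtain x1 x1' where x1: "norm (x1 - xh) < \<eta>" "?g x1 < ereal (fh + \<eta>)"
      and x1': "norm x1' \<le> \<kappa> + \<eta>" "subgrad_on UNIV ?g x1 x1'"
      using fuzzy_subgradient[OF lscg gbot ac fh(1) less_imp_le[OF \<kappa>(1)] \<eta>(1) gmin] by blast
    define D where "D = infdist x1 S"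
    have dist1: "dist x x1 < r + \<eta>"
      using x1(1) norm_triangle_ineq[of "x1 - xh" "xh - x"] by (simp add: r_def dist_norm norm_minus_commute)
    have "d \<le> D + dist x x1" unfolding d_def D_def by (rule infdist_triangle)
    then have D: "(1 - \<alpha>) * d < D" "\<alpha> * d - r < D"
      using dist1 \<eta>(2,3) by (auto simp: algebra_simps)
    have D0: "0 < D" using D r by linarith
    then have "x1 \<notin> S" using infdist_zero[of x1 S] by (auto simp: D_def)
    then have f1: "0 < f x1" by (simp add: S_def not_le)
    have g1: "?g x1 = f x1" using f1 by (auto simp: max_def)
    obtain F1 where F1: "f x1 = ereal F1" "0 < F1" using f1 x1(2) g1 by (cases "f x1") auto
    have F1_less: "F1 < \<kappa> * (\<alpha> * d - r)"
      using x1(2) \<eta>(4) fh_le \<kappa>(2) unfolding g1 F1 by (simp add: right_diff_distrib)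
    have in_ball: "x1 \<in> eball xbar \<delta>"
    proof -
      \<comment> \<open>Since \<open>xbar\<close> lies in \<open>S\<close>, a displacement of
        \<open>\<alpha> * d\<close> is at most \<open>\<alpha>\<close> times the distance from
        \<open>x\<close> to \<open>xbar\<close>; this is the origin of the radius
        \<open>\<delta> / (1 + \<alpha>)\<close>.\<close>
      have "d \<le> dist xbar x" using infdist_le[of xbar S x] xbar_in by (simp add: d_def S_def dist_commute)
      then have "\<alpha> * d \<le> \<alpha> * dist xbar x" using \<alpha> by (intro mult_left_mono) auto
      then have le: "dist xbar x1 \<le> (1 + \<alpha>) * dist xbar x"
        using dist1 \<eta>(2) dist_triangle[of xbar x1 x] by (simp add: distrib_right)
      have "ereal ((1 + \<alpha>) * dist xbar x) < \<delta>"
        using x_ball \<alpha> by (cases \<delta>) (auto simp: eball_def field_simps)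
      moreover have "ereal (dist xbar x1) \<le> ereal ((1 + \<alpha>) * dist xbar x)" using le by simp
      ultimately show ?thesis unfolding eball_def using le_less_trans by blast
    qed
    \<comment> \<open>The premise of the slope condition holds automatically at \<open>x1\<close>:
      its value is below \<open>\<kappa>\<close> times a length less than \<open>D\<close>, and
      since \<open>q \<le> 1\<close> the level \<open>\<Theta>\<close> is at most
      \<open>\<tau> * D powr (1 - q)\<close>.\<close>
    have small: "epow (f x1) q < ereal \<tau> * edist_set x1 S"
    proof -
      have "F1 powr q < (\<kappa> * (\<alpha> * d - r)) powr q"
        using F1(2) F1_less q_range by (intro powr_less_mono2) auto
      also have "\<dots> = \<kappa> powr q * (\<alpha> * d - r) powr q" using \<kappa>(1) r by (simp add: powr_mult)
      also have "\<dots> \<le> \<Theta> * D powr q"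
        using \<kappa>q D r q_range \<Theta> by (intro mult_mono powr_mono2) auto
      also have "\<dots> \<le> (\<tau> * D powr (1 - q)) * D powr q"
        unfolding \<Theta>_def using D \<alpha> d q_range tau_pos by (intro mult_right_mono mult_left_mono powr_mono2) auto
      also have "\<dots> = \<tau> * D" using D0 by (simp flip: powr_add)
      finally show ?thesis unfolding F1(1) es D_def[symmetric] by (simp add: epow_pos F1(2))
    qed
    have "x1' \<in> frechet_subdiff f x1"
      by (rule subgrad_max_0_frechet[OF f_lsc f1 _ x1'(2)]) (simp add: F1)
    then have "dist_subdiff f x1 \<le> ereal (norm x1')" unfolding dist_subdiff_def by (rule INF_lower)
    then have "dist_subdiff f x1 \<le> ereal (\<kappa> + \<eta>)" using x1'(1) by (meson ereal_less_eq(3) order.trans)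
    moreover have "0 \<le> dist_subdiff f x1" unfolding dist_subdiff_def by (intro INF_greatest) simp
    ultimately have sub: "epow (dist_subdiff f x1) q \<le> ereal ((\<kappa> + \<eta>) powr q)" using epow_le q_range(1) by blast
    have "ereal \<tau> \<le> epow (edist_set x1 S) (q - 1) * epow (dist_subdiff f x1) q"
      using slope_cond in_ball f1 small unfolding S_def by blast
    also have "\<dots> \<le> ereal (D powr (q - 1)) * ereal ((\<kappa> + \<eta>) powr q)"
      unfolding es D_def[symmetric] epow_pos[OF D0] by (intro ereal_mult_left_mono sub) simp
    finally have "\<tau> \<le> D powr (q - 1) * (\<kappa> + \<eta>) powr q" by simp
    also have "\<dots> < D powr (q - 1) * \<Theta>" using \<kappa>\<eta> D0 by (intro mult_strict_left_mono) auto
    also have "\<dots> \<le> D powr (q - 1) * (\<tau> * D powr (1 - q))"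
      unfolding \<Theta>_def using D \<alpha> d q_range tau_pos by (intro mult_left_mono powr_mono2) auto
    also have "\<dots> = \<tau>" using D0 by (simp add: mult.left_commute flip: powr_add)
    finally show False by simp
  qed
qed

end
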